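(* Let $G$ be a non-Hausdorff étale groupoid. (I) We have $J\cap\mathcal{C}_c(G)\neq\{0\}$ if and only if $G$ satisfies condition $(\mathcal{S}_0)$. (II) Let $G$ be ample and $R$ a ring. We have $J_R\neq\{0\}$ if and only if there exists $t\in\mathrm{ord}(R)$ such that $G$ satisfies condition $(\mathcal{S}_t)$.
   Context: Groupoids. A groupoid $G$ is a small category all of whose morphisms are invertible, identified with its set of morphisms; $G^{(0)}\subseteq G$ is its set of units, $r,s\colon G\to G^{(0)}$ are range and source, and $G_x=s^{-1}(x)$, $G^x=r^{-1}(x)$, $G_x^x=G_x\cap G^x$. Topological groupoids (continuous range, source, multiplication, inversion) are always assumed locally compact with $G^{(0)}$ Hausdorff in the subspace topology; $G$ itself need not be Hausdorff, and compact subsets need not be closed. $G$ is étale if $r$ is a local homeomorphism, and ample if in addition $G^{(0)}$ is totally disconnected. An open bisection is an open subset $U\subseteq G$ on which $r$ and $s$ are injective ($U$ is then locally compact Hausdorff). $C^*$-algebra. For an open bisection $U$, $C_c(U)$ is the set of continuous functions $U\to\mathbb{C}$ with compact support in $U$, extended by zero to functions on $G$; $\mathcal{C}_c(G)$ is the linear span of all $C_c(U)$, a $*$-algebra under $f^*(g)=\overline{f(g^{-1})}$ and convolution $(f_1*f_2)(g)=\sum_{g_1g_2=g}f_1(g_1)f_2(g_2)$. For $x\in G^{(0)}$, $\pi_x\colon\mathcal{C}_c(G)\to\mathcal{L}(\ell^2(G_x))$ is $\pi_x(f)\xi=f*\xi$; $C^*_r(G)$ is the completion of $\mathcal{C}_c(G)$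 in the norm $\sup_{x}\|\pi_x(f)\|$. Elements $f\in C^*_r(G)$ are viewed as functions on $G$ via $f(g)=\langle\pi_{s(g)}(f)\delta_{s(g)},\delta_g\rangle$. Steinberg algebra. Rings need not be commutative or unital. For $G$ ample and a ring $R$, $RG$ is the span of the functions $c_U\colon G\to R$ ($c\in R$, $U\subseteq G$ compact open bisection), where $c_U$ equals $c$ on $U$ and $0$ elsewhere, with convolution product. Singular ideals. For a function $f$, $\mathrm{supp}^\circ(f)=\{g: f(g)\neq0\}$. Set $J=\{f\in C^*_r(G): s(\mathrm{supp}^\circ(f))\text{ has empty interior}\}$ and, for $G$ ample, $J_R=\{f\in RG:\mathrm{supp}^\circ(f)\text{ has empty interior}\}$. Orders. For $0\neq x\in R$, $\mathrm{ord}(x)$ is the smallest positive integer $t$ with $t\cdot x=0$, and $\mathrm{ord}(x)=0$ if there is no such $t$; $\mathrm{ord}(R)=\{\mathrm{ord}(x):0\neq x\in R\}$. Put $R_0=\mathbb{Q}$ and $R_t=\mathbb{Z}/t\mathbb{Z}$ for integers $t>1$. Condition $(\mathcal{S}_t)$, for $t\in\{0,2,3,\dots\}$: there exist a positive integer $n$ and open bisections $U_1,\dots,U_n\subseteq G$ such that (1) $s(U_i)=s(U_j)$ for all $1\le i,j\le n$; (2) $U_i\setminus\bigcup_{j\neq i}U_j$ is non-empty and has empty interior for all $1\le i\le n$; (3) $\mathrm{span}_{R_t}\{b_I: I\subseteq\{1,\dots,n\},\ \#I>1,\ (\bigcap_{i\in I}U_i)\setminus(\bigcup_{j\notin I}U_j)\neq\emptyset\}\neq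 R_t^n$, where $b_I=\sum_{i\in I}b_i$ and $b_i$ is the $i$-th standard basis vector of $R_t^n$. *)

theory Defs
  imports "HOL-Analysis.Analysis" "HOL-Number_Theory.Residues"
begin

text \<open>A groupoid is identified with its set of morphisms, the carrier \<open>topspace (gtop G)\<close>.
  The product \<open>gmult G g h\<close> is meaningful only when \<open>gsrc G g = grng G h\<close>; values of the
  operations outside the carrier are irrelevant.\<close>

record 'g top_groupoid =
  gtop :: "'g topology"
  gsrc :: "'g \<Rightarrow> 'g"
  grng :: "'g \<Rightarrow> 'g"
  gmult :: "'g \<Rightarrow> 'g \<Rightarrow> 'g"
  ginv :: "'g \<Rightarrow> 'g"

definition mor :: "'g top_groupoid \<Rightarrow> 'g set" where
  "mor G = topspace (gtop G)"

definition units :: "'g top_groupoid \<Rightarrow> 'g set" where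
  "units G = gsrc G ` mor G"

definition unit_space :: "'g top_groupoid \<Rightarrow> 'g topology" where
  "unit_space G = subtopology (gtop G) (units G)"

definition composable :: "'g top_groupoid \<Rightarrow> ('g \<times> 'g) set" where
  "composable G = {(g, h). g \<in> mor G \<and> h \<in> mor G \<and> gsrc G g = grng G h}"

definition src_fibre :: "'g top_groupoid \<Rightarrow> 'g \<Rightarrow> 'g set" where
  "src_fibre G x = {g \<in> mor G. gsrc G g = x}"

locale alg_groupoid =
  fixes G :: "'g top_groupoid"
  assumes src_closed: "g \<in> mor G \<Longrightarrow> gsrc G g \<in> mor G"
    and rng_closed: "g \<in> mor G \<Longrightarrow> grng G g \<in> mor G"
    and src_src: "g \<in> mor G \<Longrightarrow> gsrc G (gsrc G g) = gsrc G g"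
    and rng_src: "g \<in> mor G \<Longrightarrow> grng G (gsrc G g) = gsrc G g"
    and src_rng: "g \<in> mor G \<Longrightarrow> gsrc G (grng G g) = grng G g"
    and rng_rng: "g \<in> mor G \<Longrightarrow> grng G (grng G g) = grng G g"
    and mult_closed: "(g, h) \<in> composable G \<Longrightarrow> gmult G g h \<in> mor G"
    and src_mult: "(g, h) \<in> composable G \<Longrightarrow> gsrc G (gmult G g h) = gsrc G h"
    and rng_mult: "(g, h) \<in> composable G \<Longrightarrow> grng G (gmult G g h) = grng G g"
    and mult_assoc: "\<lbrakk>(g, h) \<in> composable G; (h, k) \<in> composable G\<rbrakk>
      \<Longrightarrow> gmult G (gmult G g h) k = gmult G g (gmult G h k)"
    and mult_src: "g \<in> mor G \<Longrightarrow> gmult G g (gsrc G g) = g"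
    and rng_mult_left: "g \<in> mor G \<Longrightarrow> gmult G (grng G g) g = g"
    and inv_closed: "g \<in> mor G \<Longrightarrow> ginv G g \<in> mor G"
    and src_inv: "g \<in> mor G \<Longrightarrow> gsrc G (ginv G g) = grng G g"
    and rng_inv: "g \<in> mor G \<Longrightarrow> grng G (ginv G g) = gsrc G g"
    and inv_mult: "g \<in> mor G \<Longrightarrow> gmult G (ginv G g) g = gsrc G g"
    and mult_inv: "g \<in> mor G \<Longrightarrow> gmult G g (ginv G g) = grng G g"

locale topological_groupoid = alg_groupoid +
  assumes continuous_src: "continuous_map (gtop G) (unit_space G) (gsrc G)"
    and continuous_rng: "continuous_map (gtop G) (unit_space G) (grng G)"
    and continuous_mult:
      "continuous_map (subtopology (prod_topology (gtop G) (gtop G)) (composable G)) (gtop G)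
         (\<lambda>(g, h). gmult G g h)"
    and continuous_inv: "continuous_map (gtop G) (gtop G) (ginv G)"
    and locally_compact: "locally_compact_space (gtop G)"
    and Hausdorff_units: "Hausdorff_space (unit_space G)"

definition local_homeomorphism_map :: "'a topology \<Rightarrow> 'b topology \<Rightarrow> ('a \<Rightarrow> 'b) \<Rightarrow> bool" where
  "local_homeomorphism_map X Y f \<longleftrightarrow>
     f \<in> topspace X \<rightarrow> topspace Y \<and>
     (\<forall>x \<in> topspace X. \<exists>U. openin X U \<and> x \<in> U \<and> openin Y (f ` U) \<and>
        homeomorphic_map (subtopology X U) (subtopology Y (f ` U)) f)"

definition totally_disconnected_space :: "'a topology \<Rightarrow> bool" where
  "totally_disconnected_space X \<longleftrightarrow> (\<forall>S. connectedin X S \<longrightarrow> (\<exists>a. S \<subseteq> {a}))"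

locale etale_groupoid = topological_groupoid +
  assumes etale: "local_homeomorphism_map (gtop G) (unit_space G) (grng G)"

locale ample_groupoid = etale_groupoid +
  assumes totally_disconnected: "totally_disconnected_space (unit_space G)"

definition open_bisection :: "'g top_groupoid \<Rightarrow> 'g set \<Rightarrow> bool" where
  "open_bisection G U \<longleftrightarrow> openin (gtop G) U \<and> inj_on (grng G) U \<and> inj_on (gsrc G) U"

definition Cc_on :: "'g top_groupoid \<Rightarrow> 'g set \<Rightarrow> ('g \<Rightarrow> complex) set" where
  "Cc_on G U = {f. (\<forall>g. g \<notin> U \<longrightarrow> f g = 0) \<and>
     continuous_map (subtopology (gtop G) U) euclidean f \<and>
     compactin (subtopology (gtop G) U) (subtopology (gtop G) U closure_of {g \<in> U. f g \<noteq> 0})}"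

definition Cc :: "'g top_groupoid \<Rightarrow> ('g \<Rightarrow> complex) set" where
  "Cc G = {(\<lambda>g. \<Sum>i<n. a i * f i g) | (n::nat) a f.
     \<forall>i<n. \<exists>U. open_bisection G U \<and> f i \<in> Cc_on G U}"

text \<open>The sum ranges over the nonzero terms only, so that it is a finite sum whenever the first
  factor vanishes off finitely many points of every range fibre, as elements of \<open>Cc G\<close> do.\<close>

definition convolution ::
    "'g top_groupoid \<Rightarrow> ('g \<Rightarrow> complex) \<Rightarrow> ('g \<Rightarrow> complex) \<Rightarrow> 'g \<Rightarrow> complex" where
  "convolution G f1 f2 g =
     (\<Sum>(g1, g2) \<in> {(g1, g2) \<in> composable G. gmult G g1 g2 = g \<and> f1 g1 \<noteq> 0 \<and> f2 g2 \<noteq> 0}.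
        f1 g1 * f2 g2)"

text \<open>Vectors of \<open>\<ell>\<^sup>2(A)\<close> are represented as functions on the whole type that vanish outside \<open>A\<close>.\<close>

definition ell2 :: "'a set \<Rightarrow> ('a \<Rightarrow> complex) set" where
  "ell2 A = {\<xi>. (\<forall>g. g \<notin> A \<longrightarrow> \<xi> g = 0) \<and> (\<lambda>g. (cmod (\<xi> g))\<^sup>2) summable_on A}"

definition ell2_inner :: "'a set \<Rightarrow> ('a \<Rightarrow> complex) \<Rightarrow> ('a \<Rightarrow> complex) \<Rightarrow> complex" where
  "ell2_inner A \<xi> \<eta> = (\<Sum>\<^sub>\<infinity>g\<in>A. \<xi> g * cnj (\<eta> g))"

definition ell2_norm :: "'a set \<Rightarrow> ('a \<Rightarrow> complex) \<Rightarrow> real" where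
  "ell2_norm A \<xi> = sqrt (\<Sum>\<^sub>\<infinity>g\<in>A. (cmod (\<xi> g))\<^sup>2)"

definition delta :: "'a \<Rightarrow> 'a \<Rightarrow> complex" where
  "delta x g = (if g = x then 1 else 0)"

text \<open>Bounded linear operators on \<open>\<ell>\<^sup>2(A)\<close>, as extensional functions.\<close>

definition bounded_operators :: "'a set \<Rightarrow> (('a \<Rightarrow> complex) \<Rightarrow> ('a \<Rightarrow> complex)) set" where
  "bounded_operators A = {T \<in> ell2 A \<rightarrow>\<^sub>E ell2 A.
     (\<forall>\<xi> \<in> ell2 A. \<forall>\<eta> \<in> ell2 A. T (\<lambda>g. \<xi> g + \<eta> g) = (\<lambda>g. T \<xi> g + T \<eta> g)) \<and>
     (\<forall>a. \<forall>\<xi> \<in> ell2 A. T (\<lambda>g. a * \<xi> g) = (\<lambda>g. a * T \<xi> g)) \<and>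
     (\<exists>C. \<forall>\<xi> \<in> ell2 A. ell2_norm A (T \<xi>) \<le> C * ell2_norm A \<xi>)}"

definition op_norm :: "'a set \<Rightarrow> (('a \<Rightarrow> complex) \<Rightarrow> ('a \<Rightarrow> complex)) \<Rightarrow> ennreal" where
  "op_norm A T = (SUP \<xi> \<in> {\<xi> \<in> ell2 A. ell2_norm A \<xi> \<le> 1}. ennreal (ell2_norm A (T \<xi>)))"

text \<open>The family \<open>(\<pi>\<^sub>x(f))\<close> indexed by the units \<open>x\<close>.\<close>

definition regular_rep ::
    "'g top_groupoid \<Rightarrow> ('g \<Rightarrow> complex) \<Rightarrow> 'g \<Rightarrow> ('g \<Rightarrow> complex) \<Rightarrow> ('g \<Rightarrow> complex)" where
  "regular_rep G f = (\<lambda>x \<in> units G. \<lambda>\<xi> \<in> ell2 (src_fibre G x). convolution G f \<xi>)"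

definition family_norm ::
    "'g top_groupoid \<Rightarrow> ('g \<Rightarrow> ('g \<Rightarrow> complex) \<Rightarrow> ('g \<Rightarrow> complex)) \<Rightarrow> ennreal" where
  "family_norm G T = (SUP x \<in> units G. op_norm (src_fibre G x) (T x))"

text \<open>The reduced norm of \<open>f\<close> is \<open>family_norm G (regular_rep G f)\<close>. As \<open>regular_rep G\<close> is
  isometric for it and the space of families of operators with finite norm is complete,
  the completion of \<open>Cc G\<close> is realised as the closure of the image of \<open>Cc G\<close>. The extension of
  \<open>\<pi>\<^sub>x\<close> to the completion is then evaluation of a family at \<open>x\<close>.\<close>

definition reduced_Cstar ::
    "'g top_groupoid \<Rightarrow> ('g \<Rightarrow> ('g \<Rightarrow> complex) \<Rightarrow> ('g \<Rightarrow> complex)) set" where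
  "reduced_Cstar G = {T \<in> (\<Pi>\<^sub>E x \<in> units G. bounded_operators (src_fibre G x)).
     \<forall>\<epsilon>>0. \<exists>f \<in> Cc G. family_norm G (\<lambda>x \<xi> g. T x \<xi> g - regular_rep G f x \<xi> g) < \<epsilon>}"

definition as_function ::
    "'g top_groupoid \<Rightarrow> ('g \<Rightarrow> ('g \<Rightarrow> complex) \<Rightarrow> ('g \<Rightarrow> complex)) \<Rightarrow> 'g \<Rightarrow> complex" where
  "as_function G T g = (if g \<in> mor G
     then ell2_inner (src_fibre G (gsrc G g)) (T (gsrc G g) (delta (gsrc G g))) (delta g)
     else 0)"

definition osupp :: "'g top_groupoid \<Rightarrow> ('g \<Rightarrow> 'b::zero) \<Rightarrow> 'g set" where
  "osupp G f = {g \<in> mor G. f g \<noteq> 0}"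

definition singular_ideal ::
    "'g top_groupoid \<Rightarrow> ('g \<Rightarrow> ('g \<Rightarrow> complex) \<Rightarrow> ('g \<Rightarrow> complex)) set" where
  "singular_ideal G = {T \<in> reduced_Cstar G.
     unit_space G interior_of (gsrc G ` osupp G (as_function G T)) = {}}"

definition const_on :: "'r::ring \<Rightarrow> 'g set \<Rightarrow> 'g \<Rightarrow> 'r" where
  "const_on c U g = (if g \<in> U then c else 0)"

definition steinberg_algebra :: "'g top_groupoid \<Rightarrow> ('g \<Rightarrow> 'r::ring) set" where
  "steinberg_algebra G = {(\<lambda>g. \<Sum>i<n. const_on (c i) (U i) g) | (n::nat) c U.
     \<forall>i<n. open_bisection G (U i) \<and> compactin (gtop G) (U i)}"

definition steinberg_singular_ideal :: "'g top_groupoid \<Rightarrow> ('g \<Rightarrow> 'r::ring) set" where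
  "steinberg_singular_ideal G =
     {f \<in> steinberg_algebra G. gtop G interior_of (osupp G f) = {}}"

definition nat_multiple :: "nat \<Rightarrow> 'r::ring \<Rightarrow> 'r" where
  "nat_multiple t x = (\<Sum>i<t. x)"

definition add_ord :: "'r::ring \<Rightarrow> nat" where
  "add_ord x = (if \<exists>t>0. nat_multiple t x = 0 then LEAST t. t > 0 \<and> nat_multiple t x = 0 else 0)"

definition ring_ords :: "'r::ring itself \<Rightarrow> nat set" where
  "ring_ords _ = {add_ord x | x :: 'r. x \<noteq> 0}"

definition rat_ring :: "rat ring" where
  "rat_ring = \<lparr>carrier = UNIV, monoid.mult = (*), one = 1, zero = 0, add = (+)\<rparr>"

text \<open>Elements of \<open>R\<^sup>n\<close> are extensional functions on \<open>{1..n}\<close>.\<close>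

definition free_module :: "'k ring \<Rightarrow> nat \<Rightarrow> (nat \<Rightarrow> 'k) set" where
  "free_module R n = {1..n} \<rightarrow>\<^sub>E carrier R"

definition basis_vec :: "'k ring \<Rightarrow> nat \<Rightarrow> nat \<Rightarrow> (nat \<Rightarrow> 'k)" where
  "basis_vec R n i = (\<lambda>k \<in> {1..n}. if k = i then \<one>\<^bsub>R\<^esub> else \<zero>\<^bsub>R\<^esub>)"

definition basis_sum :: "'k ring \<Rightarrow> nat \<Rightarrow> nat set \<Rightarrow> (nat \<Rightarrow> 'k)" where
  "basis_sum R n I = (\<lambda>k \<in> {1..n}. \<Oplus>\<^bsub>R\<^esub>i\<in>I. basis_vec R n i k)"

definition free_span :: "'k ring \<Rightarrow> nat \<Rightarrow> (nat \<Rightarrow> 'k) set \<Rightarrow> (nat \<Rightarrow> 'k) set" where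
  "free_span R n B = {(\<lambda>k \<in> {1..n}. \<Oplus>\<^bsub>R\<^esub>b\<in>A. c b \<otimes>\<^bsub>R\<^esub> b k) | A c.
     finite A \<and> A \<subseteq> B \<and> c \<in> A \<rightarrow> carrier R}"

definition condition_S_over :: "'k ring \<Rightarrow> 'g top_groupoid \<Rightarrow> bool" where
  "condition_S_over R G \<longleftrightarrow> (\<exists>(n::nat) (U :: nat \<Rightarrow> 'g set). n > 0 \<and>
     (\<forall>i \<in> {1..n}. open_bisection G (U i)) \<and>
     (\<forall>i \<in> {1..n}. \<forall>j \<in> {1..n}. gsrc G ` U i = gsrc G ` U j) \<and>
     (\<forall>i \<in> {1..n}. U i - (\<Union>j \<in> {1..n} - {i}. U j) \<noteq> {} \<and>
        gtop G interior_of (U i - (\<Union>j \<in> {1..n} - {i}. U j)) = {}) \<and>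
     free_span R n {basis_sum R n I | I. I \<subseteq> {1..n} \<and> card I > 1 \<and>
        (\<Inter>i\<in>I. U i) - (\<Union>j \<in> {1..n} - I. U j) \<noteq> {}} \<noteq> free_module R n)"

text \<open>Intended for \<open>t \<noteq> 1\<close>; note that \<open>1\<close> is never the order of a nonzero ring element.\<close>

definition condition_S :: "nat \<Rightarrow> 'g top_groupoid \<Rightarrow> bool" where
  "condition_S t G \<longleftrightarrow>
     (if t = 0 then condition_S_over rat_ring G else condition_S_over (residue_ring (int t)) G)"

end

theory Submission
  imports Defs
begin

text \<open>Near a unit \<open>x\<close>, an element of either algebra sends \<open>g\<close> to the sum of the \<open>F i (s g)\<close> over
  those \<open>i\<close> with \<open>g \<in> V i\<close>, for finitely many bisections \<open>V i\<close> with a common source. Choose such a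
  form of a singular element \<open>f\<close>, around a unit over which \<open>f\<close> does not vanish, with as few
  bisections as possible. Then \<open>f\<close> vanishes over every unit over which two of the \<open>V i\<close> meet, so the
  values \<open>F i x\<close> sum to zero over every realised index set \<open>I\<close> with more than one element. They
  define an additive functional that kills the vectors \<open>b\<^sub>I\<close>, which therefore cannot span over
  \<open>R\<^sub>t\<close> for a suitable \<open>t\<close>, either zero or a prime.

  Conversely, if the \<open>b\<^sub>I\<close> do not span over \<open>R\<^sub>t\<close> and \<open>x\<close> has order \<open>t\<close>, there is such a
  functional with values in the multiples of \<open>x\<close>. The combination of the (cut-off) characteristic
  functions of the \<open>U i\<close> with these coefficients is nonzero only at points lying in exactly one
  \<open>U i\<close>.\<close>

section \<open>Integral multiples and orders\<close>

text \<open>The coefficient ring has no topology, perhaps no unit, and elements of different orders,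
  so only its additive group is used, with the integers acting on it. Spans over \<open>R_t\<close>
  are restated as integer congruences, which brings the rationals and the residue rings under one
  notion, \<open>generated\<close>. Elements of the algebras need not be continuous on
  \<open>G\<close>, but near a unit their coefficients are functions on the Hausdorff unit space.
  All that is kept of continuity is that nonvanishing persists nearby. Constant coefficients have
  this property too, so one argument serves both algebras. The number \<open>t\<close> comes from
  the group generated by the values at a unit. A value of infinite order leads to
  \<open>t = 0\<close>; otherwise the group has a finite exponent, and a prime divisor of it is the
  order of a multiple of some value. In the converse \<open>t\<close> may be composite, so
  \<open>R_t\<close> need not be a field and the span need not have a complement. The functional
  comes from a cyclic quotient instead, as cyclic quotients of \<open>R_t\<close> embed in
  \<open>R_t\<close>.\<close>

definition int_multiple :: "int \<Rightarrow> 'r::ring \<Rightarrow> 'r" where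
  "int_multiple k x = (if 0 \<le> k then nat_multiple (nat k) x else - nat_multiple (nat (- k)) x)"

lemma nat_multiple_Suc: "nat_multiple (Suc t) x = nat_multiple t x + x"
  by (simp add: nat_multiple_def)

lemma int_multiple_0 [simp]: "int_multiple 0 x = 0"
  by (simp add: int_multiple_def nat_multiple_def)

lemma int_multiple_1 [simp]: "int_multiple 1 x = x"
  by (simp add: int_multiple_def nat_multiple_def)

lemma int_multiple_of_nat: "int_multiple (int t) x = nat_multiple t x"
  by (simp add: int_multiple_def)

lemma int_multiple_minus: "int_multiple (- k) x = - int_multiple k x"
  by (auto simp: int_multiple_def nat_multiple_def)

lemma int_multiple_succ: "int_multiple (k + 1) x = int_multiple k x + x"
proof (cases "0 \<le> k")
  case True
  then have "nat (k + 1) = Suc (nat k)" by simp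
  with True show ?thesis by (simp add: int_multiple_def nat_multiple_Suc)
next
  case False
  define m where "m = nat (- k - 1)"
  have k: "k = - int (Suc m)" using False by (simp add: m_def)
  have "int_multiple k x = - nat_multiple (Suc m) x"
    by (simp only: k int_multiple_minus int_multiple_of_nat)
  moreover have "int_multiple (k + 1) x = - nat_multiple m x"
    unfolding k by (simp add: int_multiple_minus int_multiple_of_nat)
  ultimately show ?thesis by (simp add: nat_multiple_Suc)
qed

lemma int_multiple_pred: "int_multiple (k - 1) x = int_multiple k x - x"
  using int_multiple_succ[of "k - 1" x] by simp

lemma int_multiple_add_left: "int_multiple (k + l) x = int_multiple k x + int_multiple l x"
proof (induction l rule: int_induct[where k = 0])
  case (step1 i)
  then show ?case
    using int_multiple_succ[of "k + i" x] int_multiple_succ[of i x] by (simp add: algebra_simps)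
next
  case (step2 i)
  have "k + (i - 1) = (k + i) - 1" by simp
  with step2 show ?case by (simp only: int_multiple_pred) simp
qed simp

lemma int_multiple_add_right: "int_multiple k (x + y) = int_multiple k x + int_multiple k y"
  by (induction k rule: int_induct[where k = 0])
    (simp_all add: int_multiple_succ int_multiple_pred)

lemma int_multiple_zero [simp]: "int_multiple k 0 = 0"
  by (induction k rule: int_induct[where k = 0]) (simp_all add: int_multiple_succ int_multiple_pred)

lemma int_multiple_diff_left: "int_multiple (k - l) x = int_multiple k x - int_multiple l x"
  using int_multiple_add_left[of k "- l" x] by (simp add: int_multiple_minus)

lemma int_multiple_mult: "int_multiple (k * l) x = int_multiple k (int_multiple l x)"
  by (induction k rule: int_induct[where k = 0])
    (simp_all add: int_multiple_succ int_multiple_pred int_multiple_add_left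
      int_multiple_diff_left algebra_simps)

lemma int_multiple_sum_left: "int_multiple (\<Sum>i\<in>A. k i) x = (\<Sum>i\<in>A. int_multiple (k i) x)"
  by (induction A rule: infinite_finite_induct) (simp_all add: int_multiple_add_left)

lemma int_multiple_sum_right: "int_multiple k (\<Sum>i\<in>A. x i) = (\<Sum>i\<in>A. int_multiple k (x i))"
  by (induction A rule: infinite_finite_induct) (simp_all add: int_multiple_add_right)

lemma int_multiple_complex: "int_multiple k (z::complex) = of_int k * z"
  by (induction k rule: int_induct[where k = 0])
    (simp_all add: int_multiple_succ int_multiple_pred algebra_simps)

text \<open>Reducing \<open>k\<close> modulo a positive order leaves a remainder below the least
  annihilating multiple. Since \<open>0 dvd k\<close> forces \<open>k = 0\<close>, coding infinite
  order as 0 lets later arguments treat both cases alike.\<close>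

lemma int_multiple_eq_0_iff: "int_multiple k x = 0 \<longleftrightarrow> int (add_ord x) dvd k"
proof (cases "\<exists>t>0. nat_multiple t x = 0")
  case True
  define t where "t = add_ord x"
  have t: "t = (LEAST t. t > 0 \<and> nat_multiple t x = 0)"
    using True by (simp add: t_def add_ord_def)
  have t0: "t > 0" "nat_multiple t x = 0"
    using LeastI_ex[OF True] unfolding t by blast+
  have least: "nat_multiple s x \<noteq> 0" if "0 < s" "s < t" for s
    using not_less_Least[of s "\<lambda>t. t > 0 \<and> nat_multiple t x = 0"] that t by auto
  have split: "int_multiple k x = int_multiple (k mod int t) x"
  proof -
    have "int_multiple k x = int_multiple ((k div int t) * int t + k mod int t) x" by simp
    also have "\<dots> = int_multiple (k mod int t) x"
      unfolding int_multiple_add_left int_multiple_mult by (simp add: int_multiple_of_nat t0)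
    finally show ?thesis .
  qed
  have m: "0 \<le> k mod int t" "k mod int t < int t" using t0 by simp_all
  have "int_multiple (k mod int t) x = 0 \<longleftrightarrow> k mod int t = 0"
  proof
    assume *: "int_multiple (k mod int t) x = 0"
    show "k mod int t = 0"
    proof (rule ccontr)
      assume "k mod int t \<noteq> 0"
      then have "0 < nat (k mod int t)" "nat (k mod int t) < t" using m by linarith+
      with least * m show False by (metis int_multiple_of_nat int_nat_eq)
    qed
  qed simp
  with split show ?thesis by (simp add: t_def dvd_eq_mod_eq_0)
next
  case False
  then have o: "add_ord x = 0" unfolding add_ord_def by (rule if_not_P)
  have "int_multiple k x \<noteq> 0" if "k \<noteq> 0"
    using that False[simplified, rule_format, of "nat k"]
      False[simplified, rule_format, of "nat (- k)"]
    by (auto simp: int_multiple_def)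
  with o show ?thesis by auto
qed

text \<open>Keeps 1 out of \<open>ring_ords\<close>, so that \<open>condition_S_iff\<close> applies
  to every order of a nonzero element.\<close>

lemma add_ord_eq_1_iff: "add_ord x = 1 \<longleftrightarrow> x = 0"
  by (metis int_dvd_int_iff int_multiple_1 int_multiple_eq_0_iff nat_dvd_1_iff_1 of_nat_1)

lemma add_ord_complex: "(z::complex) \<noteq> 0 \<Longrightarrow> add_ord z = 0"
  using int_multiple_eq_0_iff[of "int (add_ord z)" z] by (simp add: int_multiple_complex)

text \<open>Denominators allowed in the integral reformulation of a span over \<open>R\<^sub>t\<close>: for \<open>t = 0\<close> the
  coefficients are rational, for \<open>t > 1\<close> integers modulo \<open>t\<close>.\<close>

definition denominators :: "nat \<Rightarrow> int set" where
  "denominators t = (if t = 0 then {0<..} else {1})"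

definition generated :: "nat \<Rightarrow> nat \<Rightarrow> nat set set \<Rightarrow> nat \<Rightarrow> bool" where
  "generated t n \<I> j \<longleftrightarrow> (\<exists>N \<in> denominators t. \<exists>d. \<forall>k \<in> {1..n}.
     int t dvd (\<Sum>I\<in>\<I>. d I * of_bool (k \<in> I)) - N * of_bool (k = j))"

section \<open>Additive relations versus integral generation\<close>

lemma one_in_denominators [simp]: "1 \<in> denominators t"
  by (simp add: denominators_def)

lemma denominators_mult: "M \<in> denominators t \<Longrightarrow> N \<in> denominators t \<Longrightarrow> M * N \<in> denominators t"
  by (auto simp: denominators_def split: if_splits)

lemma sum_multiple_indicator:
  assumes "I \<subseteq> {1..n::nat}"
  shows "(\<Sum>k=1..n. int_multiple (a * of_bool (k \<in> I)) (c k)) = int_multiple a (\<Sum>k\<in>I. c k)"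
proof -
  have "(\<Sum>k=1..n. int_multiple (a * of_bool (k \<in> I)) (c k))
      = (\<Sum>k\<in>I. int_multiple (a * of_bool (k \<in> I)) (c k))"
    using assms by (intro sum.mono_neutral_right) auto
  then show ?thesis by (simp add: int_multiple_sum_right)
qed

text \<open>Apply the functional sending \<open>b_k\<close> to \<open>c k\<close> to a congruence
  for \<open>N b_j\<close>. The vectors of the family go to zero, and what remains is the error term
  with coefficients divisible by \<open>t\<close>; it need not vanish, since \<open>c k\<close> may
  have an order not dividing \<open>t\<close>.\<close>

lemma generated_multiple:
  assumes "generated t n \<I> j" "j \<in> {1..n}"
    and I: "\<And>I. I \<in> \<I> \<Longrightarrow> I \<subseteq> {1..n} \<and> (\<Sum>i\<in>I. c i) = 0"
  shows "\<exists>N \<in> denominators t. \<exists>e. int_multiple N (c j) = (\<Sum>k=1..n. int_multiple (int t * e k) (c k))"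
proof -
  obtain N d where N: "N \<in> denominators t" and
    d: "\<And>k. k \<in> {1..n} \<Longrightarrow> int t dvd (\<Sum>I\<in>\<I>. d I * of_bool (k \<in> I)) - N * of_bool (k = j)"
    using assms(1) unfolding generated_def by blast
  from d have "\<forall>k. \<exists>e. k \<in> {1..n} \<longrightarrow>
      (\<Sum>I\<in>\<I>. d I * of_bool (k \<in> I)) - N * of_bool (k = j) = int t * e"
    by (metis dvdE)
  then obtain e where e: "\<And>k. k \<in> {1..n} \<Longrightarrow>
      (\<Sum>I\<in>\<I>. d I * of_bool (k \<in> I)) - N * of_bool (k = j) = int t * e k"
    by metis
  have "(\<Sum>k=1..n. int_multiple (int t * e k) (c k))
     = (\<Sum>k=1..n. int_multiple ((\<Sum>I\<in>\<I>. d I * of_bool (k \<in> I)) - N * of_bool (k \<in> {j})) (c k))"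
    by (intro sum.cong refl) (simp add: e)
  also have "\<dots> = (\<Sum>k=1..n. \<Sum>I\<in>\<I>. int_multiple (d I * of_bool (k \<in> I)) (c k))
      - (\<Sum>k=1..n. int_multiple (N * of_bool (k \<in> {j})) (c k))"
    by (simp only: int_multiple_diff_left int_multiple_sum_left sum_subtractf)
  also have "(\<Sum>k=1..n. \<Sum>I\<in>\<I>. int_multiple (d I * of_bool (k \<in> I)) (c k))
      = (\<Sum>I\<in>\<I>. \<Sum>k=1..n. int_multiple (d I * of_bool (k \<in> I)) (c k))"
    by (rule sum.swap)
  also have "\<dots> = 0"
    by (rule sum.neutral, rule ballI)
      (simp only: sum_multiple_indicator[OF conjunct1[OF I]] conjunct2[OF I] int_multiple_zero)
  also have "(\<Sum>k=1..n. int_multiple (N * of_bool (k \<in> {j})) (c k)) = int_multiple N (c j)"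
    by (subst sum_multiple_indicator) (use assms(2) in auto)
  finally have "int_multiple N (c j) = (\<Sum>k=1..n. int_multiple (int t * - e k) (c k))"
    by (simp add: int_multiple_minus sum_negf)
  then show ?thesis by (intro bexI[OF _ N] exI)
qed

text \<open>If some \<open>c k\<close> has infinite order, then \<open>N c_k = 0\<close> with
  \<open>N > 0\<close> is impossible, so \<open>t = 0\<close> works. Otherwise \<open>t\<close> is a
  prime dividing the exponent of the group generated by the coefficients.\<close>

lemma relation_imp_not_generated:
  fixes c :: "nat \<Rightarrow> 'r::ring"
  assumes j: "j \<in> {1..n}" "c j \<noteq> 0"
    and I: "\<And>I. I \<in> \<I> \<Longrightarrow> I \<subseteq> {1..n} \<and> (\<Sum>i\<in>I. c i) = 0"
  shows "\<exists>t \<in> ring_ords TYPE('r). \<exists>j \<in> {1..n}. \<not> generated t n \<I> j"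
proof (cases "\<exists>k \<in> {1..n}. add_ord (c k) = 0")
  case True
  then obtain k where k: "k \<in> {1..n}" "add_ord (c k) = 0" by blast
  then have "c k \<noteq> 0" by (metis add_ord_eq_1_iff zero_neq_one)
  then have 0: "0 \<in> ring_ords TYPE('r)" unfolding ring_ords_def using k by force
  have "\<not> generated 0 n \<I> k"
  proof
    assume "generated 0 n \<I> k"
    from generated_multiple[where c = c, OF this k(1) I]
    obtain N where "N \<in> denominators 0" "int_multiple N (c k) = 0" by auto
    with k show False by (simp add: int_multiple_eq_0_iff denominators_def)
  qed
  with 0 k show ?thesis by blast
next
  case False
  \<comment> \<open>The least \<open>N\<close> with \<open>P N\<close> is the exponent of the group
    generated by the coefficients; the product of their orders shows that it exists.\<close>
  define P where "P = (\<lambda>N. N > 0 \<and> (\<forall>k\<in>{1..n}. int_multiple (int N) (c k) = 0))"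
  have "P (\<Prod>k=1..n. add_ord (c k))"
    using False by (auto simp: P_def prod_pos int_multiple_eq_0_iff simp del: of_nat_prod
        intro!: dvd_prodI)
  then have ex: "\<exists>N. P N" by blast
  define N where "N = (LEAST N. P N)"
  have N: "P N" "\<And>M. M < N \<Longrightarrow> \<not> P M"
    unfolding N_def using ex by (auto intro: LeastI_ex dest: not_less_Least)
  have "N \<noteq> 1" using N(1) j by (auto simp: P_def)
  then obtain p where p: "prime p" "p dvd N" using prime_factor_nat by blast
  then obtain M where M: "N = p * M" by blast
  have "M < N" "M > 0" using N(1) M prime_gt_1_nat[OF p(1)] by (auto simp: P_def)
  with N(2)[of M] obtain k where k: "k \<in> {1..n}" "int_multiple (int M) (c k) \<noteq> 0"
    by (auto simp: P_def)
  \<comment> \<open>By minimality of the exponent \<open>N = p * M\<close>, some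
    \<open>M c_k\<close> is nonzero. As \<open>p\<close> kills it and \<open>p\<close> is prime, its
    order is exactly \<open>p\<close>, which puts \<open>p\<close> into
    \<open>ring_ords\<close>.\<close>
  define y where "y = int_multiple (int M) (c k)"
  have "int_multiple (int p) y = 0"
    using N(1) k by (simp add: y_def P_def M flip: int_multiple_mult)
  then have "add_ord y dvd p" by (simp add: int_multiple_eq_0_iff)
  moreover have "add_ord y \<noteq> 1" using k(2) unfolding y_def add_ord_eq_1_iff .
  ultimately have "add_ord y = p" using p(1) by (auto simp add: prime_nat_iff)
  then have p_ord: "p \<in> ring_ords TYPE('r)" using k unfolding ring_ords_def y_def by blast
  have "\<not> generated p n \<I> k"
  proof
    assume "generated p n \<I> k"
    from generated_multiple[where c = c, OF this k(1) I]
    obtain e where e: "c k = (\<Sum>l=1..n. int_multiple (int p * e l) (c l))"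
      using p(1) by (auto simp: denominators_def)
    \<comment> \<open>Multiplying by \<open>M\<close> turns the coefficients \<open>p e_l\<close>
      into multiples of the exponent \<open>N\<close>.\<close>
    have "y = (\<Sum>l=1..n. int_multiple (int M * (int p * e l)) (c l))"
      unfolding y_def by (subst e) (simp only: int_multiple_sum_right int_multiple_mult)
    also have "\<dots> = (\<Sum>l=1..n. int_multiple (e l) (int_multiple (int N) (c l)))"
      by (intro sum.cong refl) (simp add: M mult_ac flip: int_multiple_mult)
    also have "\<dots> = 0" using N(1) by (simp add: P_def)
    finally show False using k by (simp add: y_def)
  qed
  with p_ord k show ?thesis by blast
qed

text \<open>A nonzero map from a cyclic quotient of \<open>R_t\<close> into \<open>R_t\<close>. For
  \<open>t > 1\<close> the ideal \<open>P\<close> is generated by a divisor \<open>d\<close> of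
  \<open>t\<close> with \<open>d \<noteq> 1\<close>, and \<open>e = t / d\<close> works. For
  \<open>t = 0\<close> saturation leaves only the zero ideal, and \<open>e = 1\<close>
  works.\<close>

lemma int_ideal_annihilator:
  fixes P :: "int set"
  assumes diff: "\<And>a b. a \<in> P \<Longrightarrow> b \<in> P \<Longrightarrow> a - b \<in> P"
    and t: "t \<noteq> 1" "int t \<in> P" and N: "N \<in> denominators t" "N \<notin> P"
    and sat: "t = 0 \<Longrightarrow> P \<subseteq> {0}"
  shows "\<exists>e. (\<forall>m\<in>P. int t dvd e * m) \<and> \<not> int t dvd e * N"
proof (cases "t = 0")
  case True
  with sat N show ?thesis by (intro exI[of _ 1]) (auto simp: denominators_def)
next
  case False
  have 0: "0 \<in> P" using diff[OF t(2) t(2)] by simp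
  have add: "a + b \<in> P" if "a \<in> P" "b \<in> P" for a b
    using diff[OF that(1) diff[OF 0 that(2)]] by simp
  have mult: "q * a \<in> P" if "a \<in> P" for q a
    by (induction q rule: int_induct[where k = 0]) (auto simp: algebra_simps 0 that intro: add diff)
  define Q where "Q = (\<lambda>d. d > 0 \<and> int d \<in> P)"
  define d where "d = (LEAST d. Q d)"
  have "Q t" using False t by (simp add: Q_def)
  then have d: "Q d" "\<And>m. m < d \<Longrightarrow> \<not> Q m"
    unfolding d_def by (auto intro: LeastI dest: not_less_Least)
  have dvd: "int d dvd m" if "m \<in> P" for m
  proof -
    have "m mod int d = m - (m div int d) * int d" by (simp add: minus_div_mult_eq_mod)
    then have "m mod int d \<in> P" using diff that mult d(1) by (simp add: Q_def)
    moreover have "0 \<le> m mod int d" "m mod int d < int d" using d(1) by (simp_all add: Q_def)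
    ultimately have "m mod int d = 0"
      using d(2)[of "nat (m mod int d)"] by (force simp: Q_def)
    then show ?thesis by auto
  qed
  have N1: "N = 1" using N(1) False by (simp add: denominators_def)
  have "d \<noteq> 1" using d(1) N N1 by (auto simp: Q_def)
  obtain e where e: "t = d * e" using dvd[OF t(2)] by auto
  have "\<not> t dvd e"
    using e False \<open>d \<noteq> 1\<close> by (auto dest!: dvd_imp_le)
  moreover have "int t dvd int e * m" if "m \<in> P" for m
    using dvd[OF that] by (simp add: e mult.commute mult_dvd_mono)
  ultimately show ?thesis using N1 by (intro exI[of _ "int e"]) simp
qed

text \<open>Enlarging the span by as many basis vectors as possible while keeping it proper makes the
  quotient cyclic, generated by the image of a basis vector \<open>b\<^sub>j\<close>. The coefficient \<open>c k\<close> is a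
  multiple of \<open>x\<close> corresponding to the image of \<open>b\<^sub>k\<close> in this quotient.\<close>

lemma not_generated_imp_relation:
  fixes x :: "'r::ring"
  assumes x: "x \<noteq> 0" "add_ord x = t"
    and j0: "j0 \<in> {1..n}" "\<not> generated t n \<I> j0"
    and \<I>: "finite \<I>" "\<And>I. I \<in> \<I> \<Longrightarrow> I \<subseteq> {1..n}"
  shows "\<exists>c :: nat \<Rightarrow> 'r. (\<exists>j\<in>{1..n}. c j \<noteq> 0) \<and> (\<forall>I\<in>\<I>. (\<Sum>i\<in>I. c i) = 0)"
proof -
  define comb where "comb = (\<lambda>N v w. \<exists>d :: nat set \<Rightarrow> int. \<forall>k\<in>{1..n}.
    int t dvd (\<Sum>I\<in>\<I>. d I * of_bool (k \<in> I)) + w k - N * v k)"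
  \<comment> \<open>\<open>M S\<close> consists of the integer vectors whose image over
    \<open>R_t\<close> lies in the span of the family and of the \<open>b k\<close> with
    \<open>k \<in> S\<close>. For \<open>t = 0\<close> the multiplier \<open>N\<close> saturates it,
    so that the quotient is torsion-free.\<close>
  define M where "M = (\<lambda>S. {v. \<exists>N \<in> denominators t. \<exists>w :: nat \<Rightarrow> int.
    (\<forall>k. k \<notin> S \<longrightarrow> w k = 0) \<and> comb N v w})"
  define b :: "nat \<Rightarrow> nat \<Rightarrow> int" where "b = (\<lambda>j k. of_bool (k = j))"
  have M_diff: "(\<lambda>k. u k - v k) \<in> M S" if u: "u \<in> M S" and v: "v \<in> M S" for u v S
  proof -
    obtain N w d where 1: "N \<in> denominators t" "\<And>k. k \<notin> S \<Longrightarrow> w k = 0"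
      "\<And>k. k\<in>{1..n} \<Longrightarrow> int t dvd (\<Sum>I\<in>\<I>. d I * of_bool (k \<in> I)) + w k - N * u k"
      using u unfolding M_def comb_def by blast
    obtain N' w' d' where 2: "N' \<in> denominators t" "\<And>k. k \<notin> S \<Longrightarrow> w' k = 0"
      "\<And>k. k\<in>{1..n} \<Longrightarrow> int t dvd (\<Sum>I\<in>\<I>. d' I * of_bool (k \<in> I)) + w' k - N' * v k"
      using v unfolding M_def comb_def by blast
    have "comb (N * N') (\<lambda>k. u k - v k) (\<lambda>k. N' * w k - N * w' k)"
      unfolding comb_def
    proof (intro exI[of _ "\<lambda>I. N' * d I - N * d' I"] ballI)
      fix k assume k: "k \<in> {1..n}"
      have "(\<Sum>I\<in>\<I>. (N' * d I - N * d' I) * of_bool (k \<in> I)) + (N' * w k - N * w' k)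
            - N * N' * (u k - v k)
        = N' * ((\<Sum>I\<in>\<I>. d I * of_bool (k \<in> I)) + w k - N * u k)
        - N * ((\<Sum>I\<in>\<I>. d' I * of_bool (k \<in> I)) + w' k - N' * v k)"
        by (simp add: algebra_simps sum_subtractf sum_distrib_left)
      then show "int t dvd (\<Sum>I\<in>\<I>. (N' * d I - N * d' I) * of_bool (k \<in> I)) + (N' * w k - N * w' k)
            - N * N' * (u k - v k)"
        using dvd_mult[OF 1(3)[OF k], of N'] dvd_mult[OF 2(3)[OF k], of N] by (metis dvd_diff)
    qed
    moreover have "\<forall>k. k \<notin> S \<longrightarrow> N' * w k - N * w' k = 0" using 1 2 by simp
    ultimately show ?thesis
      unfolding M_def by (intro CollectI bexI[OF _ denominators_mult[OF 1(1) 2(1)]] exI conjI)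
  qed
  have M_0: "(\<lambda>k. 0) \<in> M S" for S
    unfolding M_def comb_def
    by (intro CollectI bexI[of _ 1] conjI exI[of _ "\<lambda>_. 0"]) simp_all
  have M_add: "(\<lambda>k. u k + v k) \<in> M S" if "u \<in> M S" "v \<in> M S" for u v S
    using M_diff[OF that(1) M_diff[OF M_0 that(2)]] by simp
  have M_mult: "(\<lambda>k. q * u k) \<in> M S" if "u \<in> M S" for q u S
    by (induction q rule: int_induct[where k = 0])
      (auto simp: algebra_simps M_0 that intro: M_add M_diff)
  have M_sum: "finite A \<Longrightarrow> (\<And>i. i \<in> A \<Longrightarrow> v i \<in> M S) \<Longrightarrow> (\<lambda>k. \<Sum>i\<in>A. v i k) \<in> M S"
    for A :: "nat set" and v S
    by (induction A rule: finite_induct) (auto intro: M_0 M_add)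
  have M_sat: "u \<in> M S" if N: "N \<in> denominators t" "(\<lambda>k. N * u k) \<in> M S" for N u S
  proof -
    obtain N' w where "N' \<in> denominators t" "\<forall>k. k \<notin> S \<longrightarrow> w k = 0" "comb N' (\<lambda>k. N * u k) w"
      using N(2) unfolding M_def by blast
    moreover from this have "comb (N' * N) u w" by (simp add: comb_def mult.assoc)
    ultimately show ?thesis
      unfolding M_def by (intro CollectI bexI[of _ "N' * N"] exI conjI denominators_mult N(1))
  qed
  have M_t: "(\<lambda>k. int t * u k) \<in> M S" for u S
    unfolding M_def comb_def by (auto intro!: bexI[of _ 1] exI[of _ "\<lambda>_. 0"])
  have M_I: "(\<lambda>k. of_bool (k \<in> I)) \<in> M S" if "I \<in> \<I>" for I S
  proof -
    have "(\<Sum>J\<in>\<I>. of_bool (J = I) * of_bool (k \<in> J)) = (of_bool (k \<in> I) :: int)" for k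
      using \<I>(1) that by (simp add: sum.delta' of_bool_def if_distrib[of "\<lambda>x. x * _"] cong: if_cong)
    then have "comb 1 (\<lambda>k. of_bool (k \<in> I)) (\<lambda>_. 0)"
      unfolding comb_def by (intro exI[of _ "\<lambda>J. of_bool (J = I)"]) simp
    then show ?thesis unfolding M_def by (auto intro!: bexI[of _ 1])
  qed
  have M_cong: "u \<in> M S \<longleftrightarrow> v \<in> M S" if "\<And>k. k \<in> {1..n} \<Longrightarrow> u k = v k" for u v S
    using that unfolding M_def comb_def by simp
  define \<S> where "\<S> = {S. S \<subseteq> {1..n} \<and> (\<exists>j\<in>{1..n}. b j \<notin> M S)}"
  have "b j0 \<notin> M {}"
  proof
    assume "b j0 \<in> M {}"
    then obtain N w d where 1: "N \<in> denominators t" "\<forall>k. w k = 0"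
      "\<And>k. k\<in>{1..n} \<Longrightarrow> int t dvd (\<Sum>I\<in>\<I>. d I * of_bool (k \<in> I)) + w k - N * b j0 k"
      unfolding M_def comb_def by blast
    have "generated t n \<I> j0"
      unfolding generated_def
    proof (intro bexI[OF _ 1(1)] exI[of _ d] ballI)
      show "int t dvd (\<Sum>I\<in>\<I>. d I * of_bool (k \<in> I)) - N * of_bool (k = j0)"
        if "k \<in> {1..n}" for k
        using 1(3)[OF that] 1(2) by (simp only: b_def add_0_right)
    qed
    with j0(2) show False by blast
  qed
  then have "{} \<in> \<S>" using j0(1) by (auto simp: \<S>_def)
  moreover have "finite \<S>" by (rule finite_subset[of _ "Pow {1..n}"]) (auto simp: \<S>_def)
  ultimately obtain S where S: "S \<in> \<S>" and max: "\<And>T. T \<in> \<S> \<Longrightarrow> S \<subseteq> T \<Longrightarrow> T = S"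
    using finite_has_maximal[of \<S>] by blast
  obtain j where j: "j \<in> {1..n}" "b j \<notin> M S" using S by (auto simp: \<S>_def)
  have "j \<notin> S"
  proof
    assume "j \<in> S"
    then have "b j \<in> M S"
      unfolding M_def comb_def b_def
      by (intro CollectI bexI[of _ 1] conjI exI[of _ "\<lambda>_. 0"] exI[of _ "\<lambda>k. of_bool (k = j)"])
        auto
    with j show False by simp
  qed
  \<comment> \<open>Adjoining \<open>j\<close> to \<open>S\<close> makes the span everything, so
    \<open>b k\<close> becomes a combination involving \<open>b j\<close>; the coefficient of
    \<open>b j\<close> is the entry \<open>w j\<close>.\<close>
  have step: "\<exists>N\<in>denominators t. \<exists>q. (\<lambda>l. N * b k l - q * b j l) \<in> M S" if k: "k \<in> {1..n}" for k
  proof -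
    have "insert j S \<notin> \<S>" using max[of "insert j S"] \<open>j \<notin> S\<close> by blast
    then have "b k \<in> M (insert j S)" using S j k by (auto simp: \<S>_def)
    then obtain N w d where 1: "N \<in> denominators t" "\<And>k. k \<notin> insert j S \<Longrightarrow> w k = 0"
      "\<And>l. l\<in>{1..n} \<Longrightarrow> int t dvd (\<Sum>I\<in>\<I>. d I * of_bool (l \<in> I)) + w l - N * b k l"
      unfolding M_def comb_def by blast
    have "(\<lambda>l. N * b k l - w j * b j l) \<in> M S"
      unfolding M_def comb_def
    proof (intro CollectI bexI[of _ 1] exI[of _ "\<lambda>l. w l - w j * b j l"] conjI exI[of _ d])
      show "\<forall>l. l \<notin> S \<longrightarrow> w l - w j * b j l = 0" using 1(2) by (auto simp: b_def)
      show "\<forall>l\<in>{1..n}. int t dvd (\<Sum>I\<in>\<I>. d I * of_bool (l \<in> I)) + (w l - w j * b j l)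
          - 1 * (N * b k l - w j * b j l)"
        using 1(3) by (auto simp: add_diff_eq)
    qed simp
    with 1 show ?thesis by blast
  qed
  \<comment> \<open>One multiplier \<open>N\<close> has to serve all \<open>k\<close>, because the
    relations are added up over a set \<open>I\<close> below; denominators are closed under
    products.\<close>
  have "\<exists>N\<in>denominators t. \<forall>k\<in>K. \<exists>q. (\<lambda>l. N * b k l - q * b j l) \<in> M S"
    if "finite K" "K \<subseteq> {1..n}" for K
    using that
  proof (induction K rule: finite_induct)
    case empty
    then show ?case using one_in_denominators by blast
  next
    case (insert k K)
    then obtain N where N: "N \<in> denominators t"
      "\<And>i. i \<in> K \<Longrightarrow> \<exists>q. (\<lambda>l. N * b i l - q * b j l) \<in> M S" by auto
    obtain N' q' where N': "N' \<in> denominators t" "(\<lambda>l. N' * b k l - q' * b j l) \<in> M S"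
      using step insert.prems by blast
    have "\<exists>q. (\<lambda>l. (N * N') * b i l - q * b j l) \<in> M S" if i: "i \<in> insert k K" for i
    proof (cases "i = k")
      case True
      then show ?thesis
        using M_mult[OF N'(2), of N] by (auto simp: algebra_simps intro!: exI[of _ "N * q'"])
    next
      case False
      then obtain q where "(\<lambda>l. N * b i l - q * b j l) \<in> M S" using N(2)[of i] i by auto
      from M_mult[OF this, of N'] show ?thesis
        by (auto simp: algebra_simps intro!: exI[of _ "N' * q"])
    qed
    then show ?case using denominators_mult[OF N(1) N'(1)] by blast
  qed
  from this[of "{1..n}"] obtain N where N: "N \<in> denominators t"
    "\<forall>k\<in>{1..n}. \<exists>q. (\<lambda>l. N * b k l - q * b j l) \<in> M S" by auto
  then obtain q' where q': "\<And>k. k \<in> {1..n} \<Longrightarrow> (\<lambda>l. N * b k l - q' k * b j l) \<in> M S"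
    by metis
  \<comment> \<open>The coefficient of \<open>b j\<close> itself may be chosen as \<open>N\<close>.
    Then \<open>c j\<close> is the multiple \<open>e * N\<close> of \<open>x\<close>, nonzero by the
    choice of \<open>e\<close>.\<close>
  define q where "q = q'(j := N)"
  have q: "(\<lambda>l. N * b k l - q k * b j l) \<in> M S" if "k \<in> {1..n}" for k
    using q'[OF that] M_0 by (auto simp: q_def)
  \<comment> \<open>\<open>P\<close> is the annihilator of the image of \<open>b j\<close> in the
    cyclic quotient.\<close>
  define P where "P = {m. (\<lambda>l. m * b j l) \<in> M S}"
  have "\<exists>e. (\<forall>m\<in>P. int t dvd e * m) \<and> \<not> int t dvd e * N"
  proof (rule int_ideal_annihilator)
    show "a - b \<in> P" if "a \<in> P" "b \<in> P" for a b
      using M_diff[of "\<lambda>l. a * _ l"] that by (simp add: P_def algebra_simps)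
    show "t \<noteq> 1" using x add_ord_eq_1_iff by metis
    show "int t \<in> P" using M_t by (simp add: P_def)
    show "N \<in> denominators t" by fact
    show "N \<notin> P" using M_sat[OF N(1)] j(2) unfolding P_def by auto
    \<comment> \<open>A nonzero \<open>m\<close> in \<open>P\<close> is up to sign a denominator, so
      saturation would put \<open>b j\<close> into \<open>M S\<close>.\<close>
    show "P \<subseteq> {0}" if t: "t = 0"
    proof
      fix m assume m: "m \<in> P"
      show "m \<in> {0}"
      proof (rule ccontr)
        assume "m \<notin> {0}"
        then have "\<bar>m\<bar> \<in> denominators t" by (simp add: t denominators_def)
        moreover have "(\<lambda>l. \<bar>m\<bar> * b j l) \<in> M S"
          using M_mult[of "\<lambda>l. m * b j l" S "sgn m"] m
          by (simp add: P_def abs_sgn mult_ac)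
        ultimately show False using M_sat j(2) by blast
      qed
    qed
  qed
  then obtain e where e: "\<And>m. m \<in> P \<Longrightarrow> int t dvd e * m" "\<not> int t dvd e * N" by blast
  define c where "c = (\<lambda>k. int_multiple (e * q k) x)"
  have "c j \<noteq> 0" using e(2) by (simp add: c_def q_def int_multiple_eq_0_iff x)
  moreover have "(\<Sum>i\<in>I. c i) = 0" if I: "I \<in> \<I>" for I
  proof -
    have fin: "finite I" "I \<subseteq> {1..n}" using \<I>(2)[OF I] finite_subset by auto
    have "(\<lambda>l. \<Sum>k\<in>I. N * b k l - q k * b j l) \<in> M S"
      using fin q by (intro M_sum) auto
    from M_diff[OF M_mult[OF M_I[OF I], of N] this]
    have "(\<lambda>l. N * of_bool (l \<in> I) - (\<Sum>k\<in>I. N * b k l - q k * b j l)) \<in> M S" .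
    \<comment> \<open>Replacing each \<open>N b_k\<close> by \<open>q k b_j\<close> modulo
      \<open>M S\<close> turns \<open>N\<close> times the vector of \<open>I\<close>, which lies in
      \<open>M S\<close>, into a multiple of \<open>b_j\<close>.\<close>
    moreover have "N * of_bool (l \<in> I) - (\<Sum>k\<in>I. N * b k l - q k * b j l) = (\<Sum>k\<in>I. q k) * b j l" for l
    proof -
      have "(\<Sum>k\<in>I. b k l) = of_bool (l \<in> I)"
        using fin(1) by (simp add: b_def of_bool_def)
      then show ?thesis
        by (simp add: sum_subtractf flip: sum_distrib_left sum_distrib_right)
    qed
    ultimately have "(\<Sum>k\<in>I. q k) \<in> P" by (simp add: P_def)
    then have "int t dvd (\<Sum>k\<in>I. e * q k)" unfolding sum_distrib_left[symmetric] by (rule e(1))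
    then show ?thesis
      by (simp add: c_def x int_multiple_eq_0_iff flip: int_multiple_sum_left)
  qed
  ultimately show ?thesis using j by blast
qed

section \<open>Spans of incidence vectors\<close>

definition incidence_vec :: "nat \<Rightarrow> nat set \<Rightarrow> nat \<Rightarrow> 'k::zero_neq_one" where
  "incidence_vec n I = (\<lambda>k \<in> {1..n}. of_bool (k \<in> I))"

text \<open>\<open>free_span\<close> sums over sets of vectors, \<open>generated\<close> over sets
  of index sets; injectivity allows passing from one to the other.\<close>

lemma inj_on_incidence_vec: "inj_on (incidence_vec n :: nat set \<Rightarrow> nat \<Rightarrow> 'k::zero_neq_one) (Pow {1..n})"
proof (rule inj_onI)
  fix I J assume IJ: "I \<in> Pow {1..n}" "J \<in> Pow {1..n}"
    and eq: "(incidence_vec n I :: nat \<Rightarrow> 'k) = incidence_vec n J"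
  have "k \<in> I \<longleftrightarrow> k \<in> J" if "k \<in> {1..n}" for k
    using fun_cong[OF eq, of k] that by (auto simp: incidence_vec_def split: if_splits)
  then show "I = J" using IJ by blast
qed

lemma incidence_vec_apply: "k \<in> {1..n} \<Longrightarrow> incidence_vec n I k = of_bool (k \<in> I)"
  by (simp add: incidence_vec_def)

section \<open>The two kinds of coefficient rings\<close>

lemma rat_ring_simps [simp]:
  "carrier rat_ring = UNIV" "\<one>\<^bsub>rat_ring\<^esub> = 1" "\<zero>\<^bsub>rat_ring\<^esub> = 0"
  "x \<oplus>\<^bsub>rat_ring\<^esub> y = x + y" "x \<otimes>\<^bsub>rat_ring\<^esub> y = x * y"
  by (simp_all add: rat_ring_def)

lemma abelian_group_rat_ring: "abelian_group rat_ring"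
proof (rule abelian_groupI)
  fix x assume "x \<in> carrier rat_ring"
  show "\<exists>y\<in>carrier rat_ring. y \<oplus>\<^bsub>rat_ring\<^esub> x = \<zero>\<^bsub>rat_ring\<^esub>"
    by (rule bexI[of _ "- x"]) simp_all
qed simp_all

lemma finsum_rat_ring: "finite A \<Longrightarrow> (\<Oplus>\<^bsub>rat_ring\<^esub>a\<in>A. f a) = sum f A"
proof -
  interpret abelian_group rat_ring by (rule abelian_group_rat_ring)
  show "finite A \<Longrightarrow> (\<Oplus>\<^bsub>rat_ring\<^esub>a\<in>A. f a) = sum f A"
    by (induction A rule: finite_induct) simp_all
qed

lemma finsum_residue_ring:
  assumes "1 < m" "finite A" "\<And>a. a \<in> A \<Longrightarrow> f a \<in> {0..m - 1}"
  shows "(\<Oplus>\<^bsub>residue_ring m\<^esub>a\<in>A. f a) = (\<Sum>a\<in>A. f a) mod m"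
proof -
  interpret residues m "residue_ring m" by unfold_locales (use assms in auto)
  show ?thesis
    using assms(2,3)
  proof (induction A rule: finite_induct)
    case empty
    then show ?case by (simp add: res_zero_eq)
  next
    case (insert a A)
    have "(\<Oplus>\<^bsub>residue_ring m\<^esub>b\<in>insert a A. f b) = f a \<oplus>\<^bsub>residue_ring m\<^esub> (\<Oplus>\<^bsub>residue_ring m\<^esub>b\<in>A. f b)"
      using insert by (intro finsum_insert) (auto simp: res_carrier_eq)
    with insert show ?case by (simp add: res_add_eq mod_add_right_eq)
  qed
qed

lemma basis_vec_rat_ring: "k \<in> {1..n} \<Longrightarrow> basis_vec rat_ring n i k = of_bool (k = i)"
  by (simp add: basis_vec_def)

lemma basis_vec_residue_ring:
  assumes "1 < m" "k \<in> {1..n}"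
  shows "basis_vec (residue_ring m) n i k = of_bool (k = i)"
proof -
  interpret residues m "residue_ring m" by unfold_locales (use assms in auto)
  show ?thesis using assms(2) by (simp add: basis_vec_def res_one_eq res_zero_eq)
qed

lemma basis_sum_rat_ring:
  assumes "I \<subseteq> {1..n}"
  shows "basis_sum rat_ring n I = incidence_vec n I"
proof -
  have "finite I" using assms finite_subset[of I "{1..n}"] by auto
  then have "(\<Oplus>\<^bsub>rat_ring\<^esub>i\<in>I. basis_vec rat_ring n i k) = of_bool (k \<in> I)" if "k \<in> {1..n}" for k
    by (simp add: finsum_rat_ring basis_vec_rat_ring[OF that] of_bool_def)
  then show ?thesis unfolding basis_sum_def incidence_vec_def by (intro restrict_ext)
qed

lemma basis_sum_residue_ring:
  assumes "1 < m" "I \<subseteq> {1..n}"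
  shows "basis_sum (residue_ring m) n I = incidence_vec n I"
proof -
  have "finite I" using assms finite_subset[of I "{1..n}"] by auto
  then have "(\<Oplus>\<^bsub>residue_ring m\<^esub>i\<in>I. basis_vec (residue_ring m) n i k) = of_bool (k \<in> I)"
    if "k \<in> {1..n}" for k
    using assms(1)
    by (simp add: finsum_residue_ring basis_vec_residue_ring[OF assms(1) that] of_bool_def)
  then show ?thesis unfolding basis_sum_def incidence_vec_def by (intro restrict_ext)
qed

lemma free_span_rat_ring:
  assumes "\<And>k. k \<in> {1..n} \<Longrightarrow> v k = (\<Sum>b\<in>A. c b * b k)" "v \<in> extensional {1..n}" "finite A" "A \<subseteq> B"
  shows "v \<in> free_span rat_ring n B"
  unfolding free_span_def using assms
  by (auto simp: finsum_rat_ring fun_eq_iff extensional_def intro!: exI[of _ A] exI[of _ c])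

lemma common_denominator:
  fixes c :: "'a \<Rightarrow> rat"
  assumes "finite A"
  shows "\<exists>N::int. N > 0 \<and> (\<forall>a\<in>A. \<exists>m::int. of_int N * c a = of_int m)"
  using assms
proof (induction A rule: finite_induct)
  case empty
  then show ?case by (auto intro!: exI[of _ 1])
next
  case (insert a A)
  then obtain N :: int where N: "N > 0" "\<And>x. x \<in> A \<Longrightarrow> \<exists>m::int. of_int N * c x = of_int m" by blast
  obtain p q where pq: "c a = Fract p q" "q > 0" by (cases "c a") auto
  have "\<exists>m::int. of_int (N * q) * c x = of_int m" if x: "x \<in> insert a A" for x
  proof (cases "x = a")
    case True
    then show ?thesis
      using pq by (intro exI[of _ "N * p"]) (simp add: Fract_of_int_quotient)
  next
    case False
    then obtain m :: int where "of_int N * c x = of_int m" using N(2)[of x] x by auto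
    then have "of_int (N * q) * c x = of_int (m * q)" by (simp add: mult.commute mult.left_commute)
    then show ?thesis ..
  qed
  then show ?case using N pq by (intro exI[of _ "N * q"]) simp
qed

text \<open>Clearing denominators in an expression for \<open>b_j\<close> gives an integral relation
  with some \<open>N > 0\<close>. Conversely, a vector \<open>v\<close> is the combination of these
  relations with weights \<open>v j / N j\<close>.\<close>

lemma free_span_rat_ring_eq_iff:
  assumes "finite \<I>" "\<And>I. I \<in> \<I> \<Longrightarrow> I \<subseteq> {1..n}"
  shows "free_span rat_ring n (basis_sum rat_ring n ` \<I>) = free_module rat_ring n
     \<longleftrightarrow> (\<forall>j\<in>{1..n}. generated 0 n \<I> j)"
proof -
  let ?b = "incidence_vec n :: nat set \<Rightarrow> nat \<Rightarrow> rat"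
  have inj: "inj_on ?b \<I>"
    using inj_on_subset[OF inj_on_incidence_vec] assms(2) by (metis PowI subsetI)
  have B: "basis_sum rat_ring n ` \<I> = ?b ` \<I>"
    using assms(2) by (intro image_cong refl basis_sum_rat_ring) blast
  show ?thesis unfolding B
  proof (intro iffI ballI)
    fix j assume eq: "free_span rat_ring n (?b ` \<I>) = free_module rat_ring n" and j: "j \<in> {1..n}"
    have "basis_vec rat_ring n j \<in> free_span rat_ring n (?b ` \<I>)"
      unfolding eq free_module_def basis_vec_def by auto
    then obtain A c where A: "finite A" "A \<subseteq> ?b ` \<I>"
      and bj: "basis_vec rat_ring n j = (\<lambda>k\<in>{1..n}. \<Sum>b\<in>A. c b * b k)"
      unfolding free_span_def by (auto simp: finsum_rat_ring)
    obtain \<J> where J: "\<J> \<subseteq> \<I>" "A = ?b ` \<J>" using A(2) by (auto simp: subset_image_iff)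
    have eqn: "(\<Sum>I\<in>\<J>. c (?b I) * of_bool (k \<in> I)) = of_bool (k = j)" if k: "k \<in> {1..n}" for k
      using fun_cong[OF bj, of k] k inj_on_subset[OF inj J(1)]
      by (simp add: J(2) sum.reindex incidence_vec_apply basis_vec_rat_ring)
    obtain N :: int where N: "N > 0" "\<And>I. I \<in> \<J> \<Longrightarrow> \<exists>m::int. of_int N * c (?b I) = of_int m"
      using common_denominator[of \<J> "\<lambda>I. c (?b I)"] finite_subset[OF J(1) assms(1)] by blast
    then obtain m :: "nat set \<Rightarrow> int" where m: "\<And>I. I \<in> \<J> \<Longrightarrow> of_int N * c (?b I) = of_int (m I)"
      by metis
    have "(\<Sum>I\<in>\<I>. (if I \<in> \<J> then m I else 0) * of_bool (k \<in> I)) = N * of_bool (k = j)"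
      if k: "k \<in> {1..n}" for k
    proof -
      have "rat_of_int (\<Sum>I\<in>\<I>. (if I \<in> \<J> then m I else 0) * of_bool (k \<in> I))
        = of_int (\<Sum>I\<in>\<J>. m I * of_bool (k \<in> I))"
        unfolding of_int_eq_iff using assms(1) J(1) by (intro sum.mono_neutral_cong_right) auto
      also have "\<dots> = (\<Sum>I\<in>\<J>. of_int N * c (?b I) * of_bool (k \<in> I))" by (simp add: m)
      also have "\<dots> = of_int N * (\<Sum>I\<in>\<J>. c (?b I) * of_bool (k \<in> I))"
        by (simp only: mult.assoc sum_distrib_left)
      also have "\<dots> = rat_of_int (N * of_bool (k = j))" by (simp only: eqn[OF k] of_int_mult of_int_of_bool)
      finally show ?thesis unfolding of_int_eq_iff .
    qed
    then show "generated 0 n \<I> j"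
      unfolding generated_def using N
      by (intro bexI[of _ N] exI[of _ "\<lambda>I. if I \<in> \<J> then m I else 0"]) (simp_all add: denominators_def)
  next
    assume gen: "\<forall>j\<in>{1..n}. generated 0 n \<I> j"
    then have "\<forall>j\<in>{1..n}. \<exists>N::int. \<exists>d. N > 0 \<and> (\<forall>k\<in>{1..n}. (\<Sum>I\<in>\<I>. d I * of_bool (k \<in> I)) = N * of_bool (k = j))"
      unfolding generated_def denominators_def
      by (simp only: if_True simp_thms of_nat_0 dvd_0_left_iff right_minus_eq greaterThan_iff Bex_def)
        blast
    then obtain N :: "nat \<Rightarrow> int" and d where N: "\<And>j. j \<in> {1..n} \<Longrightarrow> N j > 0" and
      d: "\<And>j k. j \<in> {1..n} \<Longrightarrow> k \<in> {1..n} \<Longrightarrow> (\<Sum>I\<in>\<I>. d j I * of_bool (k \<in> I)) = N j * of_bool (k = j)"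
      by metis
    have "v \<in> free_span rat_ring n (?b ` \<I>)" if v: "v \<in> free_module rat_ring n" for v
    proof (rule free_span_rat_ring[where A = "?b ` \<I>"
          and c = "\<lambda>b. \<Sum>j=1..n. v j / of_int (N j) * of_int (d j (inv_into \<I> ?b b))"])
      fix k assume k: "k \<in> {1..n}"
      have "(\<Sum>b\<in>?b ` \<I>. (\<Sum>j=1..n. v j / of_int (N j) * of_int (d j (inv_into \<I> ?b b))) * b k)
        = (\<Sum>I\<in>\<I>. (\<Sum>j=1..n. v j / of_int (N j) * of_int (d j I)) * of_bool (k \<in> I))"
        using k by (subst sum.reindex[OF inj]) (simp add: incidence_vec_apply inv_into_f_f[OF inj])
      also have "\<dots> = (\<Sum>j=1..n. \<Sum>I\<in>\<I>. v j / of_int (N j) * of_int (d j I) * of_bool (k \<in> I))"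
        by (subst sum.swap) (simp add: sum_distrib_right)
      also have "\<dots> = (\<Sum>j=1..n. v j / of_int (N j) * of_int (\<Sum>I\<in>\<I>. d j I * of_bool (k \<in> I)))"
        by (simp add: sum_distrib_left mult.assoc)
      also have "\<dots> = (\<Sum>j=1..n. v j * of_bool (k = j))"
      proof (rule sum.cong[OF refl])
        fix j assume j: "j \<in> {1..n}"
        show "v j / of_int (N j) * of_int (\<Sum>I\<in>\<I>. d j I * of_bool (k \<in> I)) = v j * of_bool (k = j)"
          using N[OF j] by (simp only: d[OF j k]) simp
      qed
      also have "\<dots> = v k" using k by (simp add: of_bool_def if_distrib[of "\<lambda>x. _ * x"] cong: if_cong)
      finally show "v k = (\<Sum>b\<in>?b ` \<I>. (\<Sum>j=1..n. v j / of_int (N j) * of_int (d j (inv_into \<I> ?b b))) * b k)"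
        by simp
    qed (use v assms(1) in \<open>auto simp: free_module_def PiE_def\<close>)
    moreover have "free_span rat_ring n (?b ` \<I>) \<subseteq> free_module rat_ring n"
      by (auto simp: free_span_def free_module_def)
    ultimately show "free_span rat_ring n (?b ` \<I>) = free_module rat_ring n" by blast
  qed
qed

text \<open>Elements of \<open>residue_ring\<close> are integers and its sums are integer sums
  reduced modulo \<open>t\<close>, so identities in it are exactly the congruences in
  \<open>generated\<close>, with multiplier 1.\<close>

lemma free_span_residue_ring_eq_iff:
  assumes "finite \<I>" "\<And>I. I \<in> \<I> \<Longrightarrow> I \<subseteq> {1..n}" and t: "1 < t"
  shows "free_span (residue_ring (int t)) n (basis_sum (residue_ring (int t)) n ` \<I>)
       = free_module (residue_ring (int t)) n
     \<longleftrightarrow> (\<forall>j\<in>{1..n}. generated t n \<I> j)"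
proof -
  let ?R = "residue_ring (int t)"
  interpret residues "int t" ?R by unfold_locales (use t in auto)
  let ?b = "incidence_vec n :: nat set \<Rightarrow> nat \<Rightarrow> int"
  have inj: "inj_on ?b \<I>"
    using inj_on_subset[OF inj_on_incidence_vec] assms(2) by (metis PowI subsetI)
  have B: "basis_sum ?R n ` \<I> = ?b ` \<I>"
    using assms by (intro image_cong refl basis_sum_residue_ring) auto
  have finsum: "(\<Oplus>\<^bsub>?R\<^esub>b\<in>A. c b \<otimes>\<^bsub>?R\<^esub> b k) = (\<Sum>b\<in>A. c b * b k) mod int t" if "finite A"
    for A :: "(nat \<Rightarrow> int) set" and c k
    using that t by (subst finsum_residue_ring) (auto simp: res_mult_eq mod_sum_eq)
  show ?thesis unfolding B
  proof (intro iffI ballI)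
    fix j assume eq: "free_span ?R n (?b ` \<I>) = free_module ?R n" and j: "j \<in> {1..n}"
    have "basis_vec ?R n j \<in> free_span ?R n (?b ` \<I>)"
      unfolding eq free_module_def basis_vec_def by auto
    then obtain A c where A: "finite A" "A \<subseteq> ?b ` \<I>"
      and bj: "basis_vec ?R n j = (\<lambda>k\<in>{1..n}. (\<Sum>b\<in>A. c b * b k) mod int t)"
      unfolding free_span_def by (auto simp: finsum)
    obtain \<J> where J: "\<J> \<subseteq> \<I>" "A = ?b ` \<J>" using A(2) by (auto simp: subset_image_iff)
    have "int t dvd (\<Sum>I\<in>\<I>. (if I \<in> \<J> then c (?b I) else 0) * of_bool (k \<in> I)) - 1 * of_bool (k = j)"
      if k: "k \<in> {1..n}" for k
    proof -
      have "(\<Sum>I\<in>\<I>. (if I \<in> \<J> then c (?b I) else 0) * of_bool (k \<in> I))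
        = (\<Sum>I\<in>\<J>. c (?b I) * of_bool (k \<in> I))"
        using assms(1) J(1) by (intro sum.mono_neutral_cong_right) auto
      moreover have "(\<Sum>I\<in>\<J>. c (?b I) * of_bool (k \<in> I)) mod int t = of_bool (k = j)"
        using fun_cong[OF bj, of k] k inj_on_subset[OF inj J(1)]
        by (simp add: J(2) sum.reindex incidence_vec_apply basis_vec_residue_ring[OF m_gt_one])
      ultimately show ?thesis
        using t by (metis mod_eq_dvd_iff mod_mod_trivial mult_1)
    qed
    then show "generated t n \<I> j"
      unfolding generated_def
      by (intro bexI[of _ 1] exI[of _ "\<lambda>I. if I \<in> \<J> then c (?b I) else 0"]) simp_all
  next
    assume gen: "\<forall>j\<in>{1..n}. generated t n \<I> j"
    then have "\<forall>j. \<exists>d. j \<in> {1..n} \<longrightarrow>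
        (\<forall>k\<in>{1..n}. int t dvd (\<Sum>I\<in>\<I>. d I * of_bool (k \<in> I)) - of_bool (k = j))"
      using t unfolding generated_def denominators_def by auto
    then obtain d where d: "\<And>j k. j \<in> {1..n} \<Longrightarrow> k \<in> {1..n} \<Longrightarrow>
        int t dvd (\<Sum>I\<in>\<I>. d j I * of_bool (k \<in> I)) - of_bool (k = j)"
      by metis
    have "v \<in> free_span ?R n (?b ` \<I>)" if v: "v \<in> free_module ?R n" for v
    proof -
      \<comment> \<open>Reduction modulo \<open>t\<close> places the coefficients in the carrier and
        leaves the sums unchanged modulo \<open>t\<close>.\<close>
      define c where "c = (\<lambda>b. (\<Sum>j=1..n. v j * d j (inv_into \<I> ?b b)) mod int t)"
      have "v k = (\<Sum>b\<in>?b ` \<I>. c b * b k) mod int t" if k: "k \<in> {1..n}" for k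
      proof -
        have "(\<Sum>b\<in>?b ` \<I>. c b * b k) mod int t
          = (\<Sum>I\<in>\<I>. (\<Sum>j=1..n. v j * d j I) mod int t * of_bool (k \<in> I)) mod int t"
          using k by (subst sum.reindex[OF inj])
            (simp add: c_def incidence_vec_apply inv_into_f_f[OF inj])
        also have "\<dots> = (\<Sum>I\<in>\<I>. (\<Sum>j=1..n. v j * d j I) * of_bool (k \<in> I)) mod int t"
          by (intro cong_sum[unfolded cong_def]) (simp add: mod_mult_left_eq)
        also have "(\<Sum>I\<in>\<I>. (\<Sum>j=1..n. v j * d j I) * of_bool (k \<in> I))
            = (\<Sum>j=1..n. \<Sum>I\<in>\<I>. v j * d j I * of_bool (k \<in> I))"
          by (subst sum.swap) (simp add: sum_distrib_right)
        also have "\<dots> = (\<Sum>j=1..n. v j * (\<Sum>I\<in>\<I>. d j I * of_bool (k \<in> I)))"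
          by (simp add: sum_distrib_left mult.assoc)
        also have "\<dots> mod int t = (\<Sum>j=1..n. v j * of_bool (k = j)) mod int t"
          using d k by (intro cong_sum[unfolded cong_def] mod_mult_cong refl) (simp add: mod_eq_dvd_iff)
        also have "\<dots> = v k mod int t"
          using k by (simp add: of_bool_def if_distrib[of "\<lambda>x. _ * x"] cong: if_cong)
        also have "\<dots> = v k"
          using v k by (force simp: free_module_def res_carrier_eq intro: mod_pos_pos_trivial)
        finally show ?thesis by simp
      qed
      then have "v = (\<lambda>k\<in>{1..n}. \<Oplus>\<^bsub>?R\<^esub>b\<in>?b ` \<I>. c b \<otimes>\<^bsub>?R\<^esub> b k)"
        using v assms(1) by (auto simp: finsum fun_eq_iff free_module_def PiE_def extensional_def)
      moreover have "c \<in> ?b ` \<I> \<rightarrow> carrier ?R" using t by (auto simp: c_def res_carrier_eq)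
      ultimately show ?thesis using assms(1) unfolding free_span_def by blast
    qed
    moreover have "free_span ?R n (?b ` \<I>) \<subseteq> free_module ?R n"
      using t by (auto simp: free_span_def free_module_def finsum res_carrier_eq)
    ultimately show "free_span ?R n (?b ` \<I>) = free_module ?R n" by blast
  qed
qed

definition realised_sets :: "nat \<Rightarrow> (nat \<Rightarrow> 'g set) \<Rightarrow> nat set set" where
  "realised_sets n U = {I. I \<subseteq> {1..n} \<and> card I > 1 \<and> (\<Inter>i\<in>I. U i) - (\<Union>j \<in> {1..n} - I. U j) \<noteq> {}}"

lemma finite_realised_sets: "finite (realised_sets n U)"
  by (rule finite_subset[of _ "Pow {1..n}"]) (auto simp: realised_sets_def)

definition exclusive_part :: "nat set \<Rightarrow> (nat \<Rightarrow> 'g set) \<Rightarrow> nat \<Rightarrow> 'g set" where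
  "exclusive_part A U i = U i - (\<Union>j \<in> A - {i}. U j)"

text \<open>Replaces two coefficient rings of different types by one integral condition in which
  \<open>t\<close> is a parameter.\<close>

lemma condition_S_iff:
  assumes "t \<noteq> 1"
  shows "condition_S t G \<longleftrightarrow> (\<exists>n U. n > 0 \<and>
     (\<forall>i \<in> {1..n}. open_bisection G (U i)) \<and>
     (\<forall>i \<in> {1..n}. \<forall>j \<in> {1..n}. gsrc G ` U i = gsrc G ` U j) \<and>
     (\<forall>i \<in> {1..n}. exclusive_part {1..n} U i \<noteq> {} \<and>
        gtop G interior_of exclusive_part {1..n} U i = {}) \<and>
     (\<exists>j \<in> {1..n}. \<not> generated t n (realised_sets n U) j))"
proof -
  have img: "{basis_sum R n I | I. I \<subseteq> {1..n} \<and> card I > 1 \<and>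
        (\<Inter>i\<in>I. U i) - (\<Union>j \<in> {1..n} - I. U j) \<noteq> {}} = basis_sum R n ` realised_sets n U"
    for R :: "'k ring" and n and U :: "nat \<Rightarrow> 'g set"
    by (auto simp: realised_sets_def)
  have sub: "\<And>I. I \<in> realised_sets n U \<Longrightarrow> I \<subseteq> {1..n}" for n and U :: "nat \<Rightarrow> 'g set"
    by (simp add: realised_sets_def)
  show ?thesis
  proof (cases "t = 0")
    case True
    have key: "free_span rat_ring n (basis_sum rat_ring n ` realised_sets n U) \<noteq> free_module rat_ring n
      \<longleftrightarrow> (\<exists>j\<in>{1..n}. \<not> generated t n (realised_sets n U) j)" for n and U :: "nat \<Rightarrow> 'g set"
      unfolding True using free_span_rat_ring_eq_iff[of "realised_sets n U" n] finite_realised_sets sub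
      by blast
    show ?thesis
      unfolding condition_S_def condition_S_over_def img exclusive_part_def
      by (simp only: key) (simp add: True)
  next
    case False
    then have t: "1 < t" using assms by simp
    have key: "free_span (residue_ring (int t)) n (basis_sum (residue_ring (int t)) n ` realised_sets n U)
        \<noteq> free_module (residue_ring (int t)) n
      \<longleftrightarrow> (\<exists>j\<in>{1..n}. \<not> generated t n (realised_sets n U) j)" for n and U :: "nat \<Rightarrow> 'g set"
      using free_span_residue_ring_eq_iff[of "realised_sets n U" n t] finite_realised_sets sub t
      by blast
    show ?thesis
      unfolding condition_S_def condition_S_over_def img exclusive_part_def
      by (simp only: key) (simp add: False)
  qed
qed

section \<open>Topology of the unit space and of bisections\<close>

lemma compact_neighbourhood:
  assumes "locally_compact_space X" "Hausdorff_space X" "openin X W" "x \<in> W"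
  shows "\<exists>U C. openin X U \<and> compactin X C \<and> x \<in> U \<and> U \<subseteq> C \<and> C \<subseteq> W"
proof -
  have "neighbourhood_base_of (compactin X) X"
    using locally_compact_space_neighbourhood_base[of X] assms(1,2) by simp
  then show ?thesis using assms(3,4) unfolding neighbourhood_base_of by simp
qed

text \<open>In a compact Hausdorff neighbourhood \<open>C\<close> of \<open>x\<close>
  quasi-components are components, hence points. So a clopen subset \<open>K\<close> of
  \<open>C\<close> contains \<open>x\<close> and avoids the compact set \<open>C - O'\<close>; lying
  in the open set \<open>O'\<close>, it is open in the whole space.\<close>

lemma compact_open_neighbourhood:
  assumes X: "locally_compact_space X" "Hausdorff_space X" "totally_disconnected_space X"
    and W: "openin X W" "x \<in> W"
  shows "\<exists>K. openin X K \<and> compactin X K \<and> x \<in> K \<and> K \<subseteq> W"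
proof -
  obtain O' C where O: "openin X O'" "compactin X C" "x \<in> O'" "O' \<subseteq> C" "C \<subseteq> W"
    using compact_neighbourhood[OF X(1,2) W] by blast
  let ?C = "subtopology X C"
  have C_top: "topspace ?C = C" using compactin_subset_topspace[OF O(2)] by auto
  have cpt: "compact_space ?C" using O(2) by (rule compact_space_subtopology)
  have "Hausdorff_space ?C" using X(2) by (rule Hausdorff_space_subtopology)
  then have quasi: "quasi_components_of ?C = connected_components_of ?C"
    using quasi_eq_connected_components_of cpt by blast
  have "x \<in> topspace ?C" using C_top O by blast
  then obtain Q where Q: "Q \<in> quasi_components_of ?C" "x \<in> Q"
    by (rule topspace_imp_quasi_components_of)
  have "connectedin X Q"
    using connectedin_connected_components_of[of Q ?C] Q(1)
    unfolding quasi by (simp add: connectedin_subtopology)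
  then have Q_eq: "Q = {x}" using X(3) Q(2) unfolding totally_disconnected_space_def by blast
  have "closedin ?C (C - O')"
    using openin_subtopology_Int2[OF O(1), of C] C_top closedin_def[of ?C "C - O'"]
    by (simp add: Diff_Diff_Int Int_commute)
  then have "compactin ?C (C - O')" using cpt by (simp add: closedin_compact_space)
  with Q(1) have "separated_between ?C Q (C - O')"
    using Q_eq O(3) by (simp add: separated_between_quasi_component_compact)
  then obtain K where K: "closedin ?C K" "openin ?C K" "x \<in> K" "C - O' \<subseteq> topspace ?C - K"
    unfolding separated_between Q_eq by blast
  have "K \<subseteq> C" using K(1) closedin_subset C_top by blast
  then have KO: "K \<subseteq> O'" using K(4) by blast
  obtain T where T: "openin X T" "K = T \<inter> C" using K(2) by (auto simp: openin_subtopology)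
  have "K = T \<inter> O'" using T(2) KO O(4) by blast
  then have "openin X K" using T(1) O(1) by auto
  moreover have "compactin X K"
    using closedin_compact_space[OF cpt K(1)] by (simp add: compactin_subtopology)
  ultimately show ?thesis using K(3) \<open>K \<subseteq> C\<close> O(5) by blast
qed

lemma bump_function:
  assumes X: "locally_compact_space X" "Hausdorff_space X"
    and W: "openin X W" "x \<in> W"
  shows "\<exists>h C. continuous_map X euclideanreal h \<and> h x = 1 \<and> compactin X C \<and> C \<subseteq> W \<and>
    (\<forall>y \<in> topspace X - C. h y = 0)"
proof -
  obtain O' C where O: "openin X O'" "compactin X C" "x \<in> O'" "O' \<subseteq> C" "C \<subseteq> W"
    using compact_neighbourhood[OF X(1,2) W] by blast
  have "completely_regular_space X"
    using locally_compact_regular_imp_completely_regular_space X by blast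
  moreover have "closedin X (topspace X - O')" "x \<in> topspace X - (topspace X - O')"
    using O(1,3) openin_subset by blast+
  ultimately obtain f where f: "continuous_map X (top_of_set {0..1::real}) f" "f x = 0"
    "f ` (topspace X - O') \<subseteq> {1}"
    unfolding completely_regular_space_def by blast
  have "continuous_map X euclideanreal (\<lambda>y. 1 - f y)"
    using f(1) by (intro continuous_map_diff continuous_map_const[THEN iffD2])
      (auto simp: continuous_map_in_subtopology)
  moreover have "1 - f y = 0" if "y \<in> topspace X - C" for y
    using f(3) that O(4) by auto
  ultimately show ?thesis using f(2) O by (intro exI[of _ "\<lambda>y. 1 - f y"] exI[of _ C]) auto
qed

lemma local_homeomorphism_imp_open_map:
  assumes "local_homeomorphism_map X Y f"
  shows "open_map X Y f"
  unfolding open_map_def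
proof (intro allI impI)
  fix U assume U: "openin X U"
  show "openin Y (f ` U)"
  proof (subst openin_subopen, rule ballI)
    fix y assume "y \<in> f ` U"
    then obtain x where x: "x \<in> U" "y = f x" by blast
    with U have "x \<in> topspace X" using openin_subset by blast
    then obtain V where V: "openin X V" "x \<in> V" "openin Y (f ` V)"
      "homeomorphic_map (subtopology X V) (subtopology Y (f ` V)) f"
      using assms unfolding local_homeomorphism_map_def by blast
    have "openin (subtopology X V) (U \<inter> V)"
      using U by (simp add: openin_subtopology_Int)
    then have "openin (subtopology Y (f ` V)) (f ` (U \<inter> V))"
      using homeomorphic_imp_open_map[OF V(4)] by (simp add: open_map_def)
    then have "openin Y (f ` (U \<inter> V))" using V(3) by (rule openin_trans_full)
    then show "\<exists>T. openin Y T \<and> y \<in> T \<and> T \<subseteq> f ` U" using x V(2) by blast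
  qed
qed

section \<open>Groupoid identities and the source map on bisections\<close>

context alg_groupoid
begin

lemma units_subset_mor: "units G \<subseteq> mor G"
  by (auto simp: units_def src_closed)

lemma topspace_unit_space [simp]: "topspace (unit_space G) = units G"
  using units_subset_mor by (auto simp: unit_space_def mor_def)

lemma src_in_units: "g \<in> mor G \<Longrightarrow> gsrc G g \<in> units G"
  by (simp add: units_def)

lemma src_unit: "x \<in> units G \<Longrightarrow> gsrc G x = x"
  by (auto simp: units_def src_src)

lemma inv_inv: "g \<in> mor G \<Longrightarrow> ginv G (ginv G g) = g"
proof -
  assume g: "g \<in> mor G"
  let ?h = "ginv G g" and ?k = "ginv G (ginv G g)"
  have "?k = gmult G ?k (gsrc G ?k)" using g by (simp add: mult_src inv_closed)
  also have "\<dots> = gmult G ?k (gmult G ?h g)" using g by (simp add: src_inv rng_inv inv_closed inv_mult)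
  also have "\<dots> = gmult G (gmult G ?k ?h) g"
    using g by (subst mult_assoc) (auto simp: composable_def src_inv rng_inv inv_closed)
  also have "\<dots> = gmult G (grng G g) g" using g by (simp add: inv_mult inv_closed src_inv)
  also have "\<dots> = g" using g by (rule rng_mult_left)
  finally show ?thesis .
qed

lemma inv_mult_cancel:
  assumes "(g, h) \<in> composable G"
  shows "gmult G (ginv G g) (gmult G g h) = h"
proof -
  have gh: "g \<in> mor G" "h \<in> mor G" "gsrc G g = grng G h" using assms by (auto simp: composable_def)
  have "gmult G (ginv G g) (gmult G g h) = gmult G (gmult G (ginv G g) g) h"
    using gh assms by (subst mult_assoc) (auto simp: composable_def src_inv inv_closed)
  then show ?thesis using gh by (simp add: inv_mult rng_mult_left)
qed

lemma mult_inv_cancel: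
  assumes "g \<in> mor G" "k \<in> mor G" "grng G g = grng G k"
  shows "gmult G g (gmult G (ginv G g) k) = k"
  using inv_mult_cancel[of "ginv G g" k] assms
  by (simp add: composable_def inv_inv inv_closed src_inv)

end

context etale_groupoid
begin

lemma open_map_rng: "open_map (gtop G) (unit_space G) (grng G)"
  using etale by (rule local_homeomorphism_imp_open_map)

text \<open>Being etale is stated for the range. Inversion exchanges range and source, so the source
  of \<open>U\<close> is the range of the preimage of \<open>U\<close> under inversion.\<close>

lemma open_map_src: "open_map (gtop G) (unit_space G) (gsrc G)"
  unfolding open_map_def
proof (intro allI impI)
  fix U assume U: "openin (gtop G) U"
  then have sub: "U \<subseteq> mor G" using openin_subset mor_def by metis
  have "gsrc G ` U = grng G ` {g \<in> topspace (gtop G). ginv G g \<in> U}"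
  proof safe
    fix g assume "g \<in> U"
    then show "gsrc G g \<in> grng G ` {g \<in> topspace (gtop G). ginv G g \<in> U}"
      using sub by (intro image_eqI[of _ _ "ginv G g"]) (auto simp: rng_inv inv_inv inv_closed simp flip: mor_def)
  next
    fix g assume "g \<in> topspace (gtop G)" "ginv G g \<in> U"
    then show "grng G g \<in> gsrc G ` U"
      by (intro image_eqI[of _ _ "ginv G g"]) (simp_all add: src_inv flip: mor_def)
  qed
  then show "openin (unit_space G) (gsrc G ` U)"
    using open_map_rng openin_continuous_map_preimage[OF continuous_inv U] by (simp add: open_map_def)
qed

lemma open_bisection_subset: "open_bisection G U \<Longrightarrow> U \<subseteq> mor G"
  unfolding open_bisection_def mor_def using openin_subset by blast

lemma openin_src_image: "openin (gtop G) U \<Longrightarrow> openin (unit_space G) (gsrc G ` U)"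
  using open_map_src by (simp add: open_map_def)

lemma openin_src_preimage:
  assumes "openin (gtop G) U" "openin (unit_space G) W"
  shows "openin (gtop G) {g \<in> U. gsrc G g \<in> W}"
  using openin_continuous_map_preimage_gen[OF continuous_src assms] .

lemma open_bisection_restrict:
  assumes "open_bisection G U" "openin (unit_space G) W"
  shows "open_bisection G {g \<in> U. gsrc G g \<in> W}"
  using assms openin_src_preimage unfolding open_bisection_def inj_on_def by blast

lemma open_bisection_homeomorphic:
  assumes "open_bisection G U"
  shows "homeomorphic_map (subtopology (gtop G) U) (subtopology (unit_space G) (gsrc G ` U)) (gsrc G)"
proof (rule bijective_open_imp_homeomorphic_map)
  have U: "openin (gtop G) U" "inj_on (gsrc G) U" "U \<subseteq> topspace (gtop G)"
    using assms openin_subset by (auto simp: open_bisection_def)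
  show "continuous_map (subtopology (gtop G) U) (subtopology (unit_space G) (gsrc G ` U)) (gsrc G)"
    using U continuous_src
    by (auto simp: continuous_map_in_subtopology continuous_map_from_subtopology)
  show "open_map (subtopology (gtop G) U) (subtopology (unit_space G) (gsrc G ` U)) (gsrc G)"
    using U openin_src_image unfolding open_map_def
    by (auto simp: openin_open_subtopology)
  show "gsrc G ` topspace (subtopology (gtop G) U) = topspace (subtopology (unit_space G) (gsrc G ` U))"
    using U src_in_units by (auto simp: mor_def)
  show "inj_on (gsrc G) (topspace (subtopology (gtop G) U))"
    using U by (auto simp: inj_on_def)
qed

text \<open>The continuous inverse of the source on \<open>U\<close> carries \<open>C\<close> to
  this set. It turns compact sets of units into compact supports in \<open>G\<close>.\<close>

lemma compactin_lift:
  assumes "open_bisection G U" "compactin (unit_space G) C" "C \<subseteq> gsrc G ` U"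
  shows "compactin (gtop G) {g \<in> U. gsrc G g \<in> C}"
proof -
  obtain \<sigma> where \<sigma>: "homeomorphic_maps (subtopology (gtop G) U)
      (subtopology (unit_space G) (gsrc G ` U)) (gsrc G) \<sigma>"
    using open_bisection_homeomorphic[OF assms(1)] homeomorphic_map_maps by blast
  have top: "topspace (subtopology (gtop G) U) = U"
    "topspace (subtopology (unit_space G) (gsrc G ` U)) = gsrc G ` U"
    using open_bisection_subset[OF assms(1)] src_in_units by (auto simp: mor_def)
  have s\<sigma>: "\<sigma> y \<in> U \<and> gsrc G (\<sigma> y) = y" if "y \<in> gsrc G ` U" for y
    using \<sigma> that unfolding homeomorphic_maps_def top continuous_map_def by auto
  have \<sigma>s: "\<sigma> (gsrc G g) = g" if "g \<in> U" for g
    using \<sigma> that unfolding homeomorphic_maps_def top by auto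
  have "compactin (subtopology (unit_space G) (gsrc G ` U)) C"
    using assms by (simp add: compactin_subtopology)
  then have "compactin (subtopology (gtop G) U) (\<sigma> ` C)"
    using \<sigma> unfolding homeomorphic_maps_def by (blast intro: image_compactin)
  moreover have "\<sigma> ` C = {g \<in> U. gsrc G g \<in> C}"
    using s\<sigma> \<sigma>s assms(3) by (force simp: image_iff)
  ultimately show ?thesis by (simp add: compactin_subtopology)
qed

text \<open>The source map is open and fixes units, so it carries a compact neighbourhood in
  \<open>G\<close> to one in the unit space.\<close>

lemma locally_compact_unit_space: "locally_compact_space (unit_space G)"
  unfolding locally_compact_space_def
proof
  fix x assume "x \<in> topspace (unit_space G)"
  then have x: "x \<in> units G" "x \<in> topspace (gtop G)" using units_subset_mor by (auto simp: mor_def)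
  then obtain U K where UK: "openin (gtop G) U" "compactin (gtop G) K" "x \<in> U" "U \<subseteq> K"
    using locally_compact unfolding locally_compact_space_def by blast
  have "x \<in> gsrc G ` U" using src_unit[OF x(1)] UK(3) by (metis image_eqI)
  then show "\<exists>U K. openin (unit_space G) U \<and> compactin (unit_space G) K \<and> x \<in> U \<and> U \<subseteq> K"
    using UK openin_src_image image_compactin[OF UK(2) continuous_src]
    by (intro exI[of _ "gsrc G ` U"] exI[of _ "gsrc G ` K"]) auto
qed

text \<open>Compact subsets of \<open>G\<close> need not be closed, but their images in the
  Hausdorff unit space are. This is what lets \<open>local_form_exists\<close> discard terms away
  from \<open>x\<close>.\<close>

lemma closedin_src_image_compact:
  "compactin (gtop G) K \<Longrightarrow> closedin (unit_space G) (gsrc G ` K)"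
  using compactin_imp_closedin[OF Hausdorff_units] image_compactin[OF _ continuous_src] by blast

end

section \<open>Local forms of singular elements\<close>

text \<open>The last clause stands in for continuity of the \<open>F i\<close>, as an arbitrary ring
  has no topology. It is asked of all partial sums because merging bisections adds coefficient
  functions, and openness for two functions separately says nothing about their sum.\<close>

definition (in etale_groupoid) local_form ::
    "('a \<Rightarrow> 'r::ring) \<Rightarrow> 'a \<Rightarrow> nat set \<Rightarrow> 'a set \<Rightarrow> (nat \<Rightarrow> 'a set) \<Rightarrow> (nat \<Rightarrow> 'a \<Rightarrow> 'r) \<Rightarrow> bool" where
  "local_form f x A W V F \<longleftrightarrow> finite A \<and> openin (unit_space G) W \<and> x \<in> W \<and>
     (\<forall>i\<in>A. open_bisection G (V i) \<and> gsrc G ` V i = W) \<and>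
     (\<forall>g\<in>mor G. gsrc G g \<in> W \<longrightarrow> f g = (\<Sum>i\<in>{i\<in>A. g \<in> V i}. F i (gsrc G g))) \<and>
     (\<forall>I\<subseteq>A. openin (unit_space G) {y\<in>W. (\<Sum>i\<in>I. F i y) \<noteq> 0})"

context etale_groupoid
begin

text \<open>Above the source of their overlap the two bisections coincide, since the source is
  injective on each. One of them can then be dropped after adding its coefficient to that of the
  other.\<close>

lemma local_form_merge:
  fixes f :: "'a \<Rightarrow> 'r::ring"
  assumes lf: "local_form f x A W V F" and ij: "i \<in> A" "j \<in> A" "i \<noteq> j"
    and h: "h \<in> V i" "h \<in> V j"
  shows "\<exists>W' V' F'. local_form f (gsrc G h) (A - {j}) W' V' F'"
proof -
  have A: "finite A" and W: "openin (unit_space G) W"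
    and V: "\<And>k. k \<in> A \<Longrightarrow> open_bisection G (V k)" "\<And>k. k \<in> A \<Longrightarrow> gsrc G ` V k = W"
    and f: "\<And>g. g \<in> mor G \<Longrightarrow> gsrc G g \<in> W \<Longrightarrow> f g = (\<Sum>i\<in>{i\<in>A. g \<in> V i}. F i (gsrc G g))"
    and F: "\<And>I. I \<subseteq> A \<Longrightarrow> openin (unit_space G) {y\<in>W. (\<Sum>i\<in>I. F i y) \<noteq> 0}"
    using lf unfolding local_form_def by blast+
  define W' where "W' = gsrc G ` (V i \<inter> V j)"
  define V' where "V' = (\<lambda>k. {g \<in> V k. gsrc G g \<in> W'})"
  define F' where "F' = F(i := \<lambda>y. F i y + F j y)"
  have W': "openin (unit_space G) W'"
    unfolding W'_def using V(1) ij by (intro openin_src_image) (auto simp: open_bisection_def)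
  have W'W: "W' \<subseteq> W" using V(2)[OF ij(1)] by (auto simp: W'_def)
  have same: "g \<in> V i \<longleftrightarrow> g \<in> V j" if g: "gsrc G g \<in> W'" for g
  proof -
    obtain g' where g': "g' \<in> V i" "g' \<in> V j" "gsrc G g' = gsrc G g" using g by (force simp: W'_def)
    have "inj_on (gsrc G) (V i)" "inj_on (gsrc G) (V j)"
      using V(1) ij by (auto simp: open_bisection_def)
    with g' show ?thesis by (metis inj_onD)
  qed
  have "local_form f (gsrc G h) (A - {j}) W' V' F'"
    unfolding local_form_def
  proof (intro conjI ballI allI impI)
    show "gsrc G h \<in> W'" using h by (auto simp: W'_def)
    fix k assume k: "k \<in> A - {j}"
    show "open_bisection G (V' k)" using V(1) W' k by (simp add: V'_def open_bisection_restrict)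
    show "gsrc G ` V' k = W'" using W'W V(2)[of k] k by (auto simp: V'_def)
  next
    fix g assume g: "g \<in> mor G" "gsrc G g \<in> W'"
    define B where "B = {k \<in> A - {i, j}. g \<in> V k}"
    have B: "finite B" "i \<notin> B" "j \<notin> B" using A by (auto simp: B_def)
    have F'B: "(\<Sum>k\<in>B. F' k (gsrc G g)) = (\<Sum>k\<in>B. F k (gsrc G g))"
      using B by (intro sum.cong) (auto simp: F'_def)
    show "f g = (\<Sum>k\<in>{k \<in> A - {j}. g \<in> V' k}. F' k (gsrc G g))"
    proof (cases "g \<in> V i")
      case True
      then have "{k\<in>A. g \<in> V k} = insert i (insert j B)" "{k \<in> A - {j}. g \<in> V' k} = insert i B"
        using ij same[OF g(2)] g(2) by (auto simp: B_def V'_def)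
      then show ?thesis
        using B ij(3) f[OF g(1)] W'W g(2) F'B by (auto simp: F'_def add.assoc)
    next
      case False
      then have "{k\<in>A. g \<in> V k} = B" "{k \<in> A - {j}. g \<in> V' k} = B"
        using ij same[OF g(2)] g(2) by (auto simp: B_def V'_def)
      then show ?thesis using f[OF g(1)] W'W g(2) F'B by auto
    qed
  next
    fix I assume I: "I \<subseteq> A - {j}"
    \<comment> \<open>A partial sum of the new coefficients is one of the old coefficients, with
      \<open>j\<close> accompanying \<open>i\<close>.\<close>
    define J where "J = (if i \<in> I then insert j I else I)"
    have fin: "finite I" using I A finite_subset by blast
    have "j \<notin> I" using I by blast
    have "(\<Sum>k\<in>I. F' k y) = (\<Sum>k\<in>J. F k y)" for y
    proof (cases "i \<in> I")
      case True
      then have "(\<Sum>k\<in>I. F' k y) = F' i y + (\<Sum>k\<in>I - {i}. F' k y)"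
        using fin by (simp add: sum.remove)
      also have "(\<Sum>k\<in>I - {i}. F' k y) = (\<Sum>k\<in>I - {i}. F k y)"
        by (intro sum.cong) (auto simp: F'_def)
      also have "F' i y + \<dots> = F j y + (\<Sum>k\<in>I. F k y)"
        using fin True by (simp add: F'_def sum.remove[of I i] add_ac)
      finally show ?thesis using True fin \<open>j \<notin> I\<close> by (simp add: J_def)
    next
      case False
      then show ?thesis by (intro sum.cong) (auto simp: J_def F'_def)
    qed
    moreover have "J \<subseteq> A" using I ij by (auto simp: J_def)
    moreover have "{y \<in> W'. (\<Sum>k\<in>J. F k y) \<noteq> 0} = W' \<inter> {y \<in> W. (\<Sum>k\<in>J. F k y) \<noteq> 0}"
      using W'W by auto
    ultimately show "openin (unit_space G) {y \<in> W'. (\<Sum>k\<in>I. F' k y) \<noteq> 0}"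
      using F W' by auto
  qed (use A W' in auto)
  then show ?thesis by blast
qed

text \<open>A term whose compact set \<open>K i\<close> does not meet the fibre over
  \<open>x\<close> vanishes over a neighbourhood of \<open>x\<close>, because the source of
  \<open>K i\<close> is closed. The remaining terms, indexed by \<open>A\<close>, have bisections
  whose sources contain \<open>x\<close>, and these are cut down to a common source.\<close>

lemma local_form_exists:
  fixes f :: "'a \<Rightarrow> 'r::ring"
  assumes x: "x \<in> units G"
    and U: "\<And>i. i < n \<Longrightarrow> open_bisection G (U i)"
    and K: "\<And>i. i < n \<Longrightarrow> compactin (gtop G) (K i)" "\<And>i. i < n \<Longrightarrow> K i \<subseteq> U i"
    and p: "\<And>i g. i < n \<Longrightarrow> g \<notin> K i \<Longrightarrow> p i g = 0"
      "\<And>i g. i < n \<Longrightarrow> g \<in> U i \<Longrightarrow> p i g = F i (gsrc G g)"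
    and f: "f = (\<lambda>g. \<Sum>i<n. p i g)"
    and F: "\<And>I W. I \<subseteq> {..<n} \<Longrightarrow> openin (unit_space G) W \<Longrightarrow> (\<And>i. i \<in> I \<Longrightarrow> W \<subseteq> gsrc G ` U i)
      \<Longrightarrow> openin (unit_space G) {y \<in> W. (\<Sum>i\<in>I. F i y) \<noteq> 0}"
  shows "\<exists>A W V. local_form f x A W V F"
proof -
  define A where "A = {i. i < n \<and> x \<in> gsrc G ` K i}"
  define W where "W = units G \<inter> (\<Inter>i\<in>A. gsrc G ` U i) \<inter> (\<Inter>i\<in>{..<n} - A. units G - gsrc G ` K i)"
  define V where "V = (\<lambda>i. {g \<in> U i. gsrc G g \<in> W})"
  have fin: "finite A" "A \<subseteq> {..<n}" by (auto simp: A_def)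
  have W1: "openin (unit_space G) (gsrc G ` U i)" if "i \<in> A" for i
    using U that by (intro openin_src_image) (auto simp: A_def open_bisection_def)
  have W2: "openin (unit_space G) (units G - gsrc G ` K i)" if "i < n" for i
    using closedin_src_image_compact[OF K(1)[OF that]] by (simp add: closedin_def)
  \<comment> \<open>The member \<open>units G\<close> keeps the family nonempty, so its intersection
    is an open set of units even when \<open>n = 0\<close>.\<close>
  define \<W> where "\<W> = insert (units G) ((\<lambda>i. gsrc G ` U i) ` A \<union> (\<lambda>i. units G - gsrc G ` K i) ` ({..<n} - A))"
  have "openin (unit_space G) (\<Inter>\<W>)"
    using W1 W2 fin openin_topspace[of "unit_space G"] by (intro openin_Inter) (auto simp: \<W>_def)
  moreover have "\<Inter>\<W> = W" by (auto simp: \<W>_def W_def)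
  ultimately have W: "openin (unit_space G) W" by simp
  have "local_form f x A W V F"
    unfolding local_form_def
  proof (intro conjI ballI allI impI)
    show "x \<in> W" using x K(2) by (auto simp: W_def A_def)
    fix i assume i: "i \<in> A"
    show "open_bisection G (V i)" using U W i by (simp add: V_def open_bisection_restrict A_def)
    have "W \<subseteq> gsrc G ` U i" using i by (auto simp: W_def)
    then show "gsrc G ` V i = W" by (auto simp: V_def)
  next
    fix g assume g: "g \<in> mor G" "gsrc G g \<in> W"
    have "(\<Sum>i<n. p i g) = (\<Sum>i\<in>{i\<in>A. g \<in> V i}. p i g)"
    proof (rule sum.mono_neutral_right)
      show "\<forall>i\<in>{..<n} - {i \<in> A. g \<in> V i}. p i g = 0"
      proof
        fix i assume i: "i \<in> {..<n} - {i \<in> A. g \<in> V i}"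
        have "g \<notin> K i"
        proof (cases "i \<in> A")
          case True
          with i g(2) have "g \<notin> U i" by (auto simp: V_def)
          with i K(2) show ?thesis by auto
        next
          case False
          with i g(2) have "gsrc G g \<notin> gsrc G ` K i" unfolding W_def by blast
          then show ?thesis by blast
        qed
        with p(1) i show "p i g = 0" by auto
      qed
    qed (use fin in auto)
    also have "\<dots> = (\<Sum>i\<in>{i\<in>A. g \<in> V i}. F i (gsrc G g))"
      using p(2) fin by (intro sum.cong) (auto simp: V_def)
    finally show "f g = (\<Sum>i\<in>{i\<in>A. g \<in> V i}. F i (gsrc G g))" by (simp add: f)
  next
    fix I assume "I \<subseteq> A"
    then show "openin (unit_space G) {y \<in> W. (\<Sum>i\<in>I. F i y) \<noteq> 0}"
      using fin W by (intro F) (auto simp: W_def)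
  qed (use fin W in auto)
  then show ?thesis by blast
qed

text \<open>Shrinking a local form with as few bisections as possible. By minimality, the bisections are
  pairwise disjoint over every unit above which \<open>f\<close> does not vanish, so the values at \<open>x\<close> of the
  coefficient functions sum to zero over every realised set with at least two elements. Discarding
  the bisections whose coefficient function vanishes at \<open>x\<close> preserves this.\<close>

lemma local_form_imp_relation:
  fixes f :: "'a \<Rightarrow> 'r::ring"
  assumes lf: "\<And>x. x \<in> units G \<Longrightarrow> \<exists>A W V F. local_form f x A W V F"
    and nonzero: "g1 \<in> mor G" "f g1 \<noteq> 0"
    and singular: "gtop G interior_of osupp G f = {}"
  obtains A U and a :: "nat \<Rightarrow> 'r" where "finite A" "A \<noteq> {}"
    "\<And>i. i \<in> A \<Longrightarrow> open_bisection G (U i)"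
    "\<And>i j. i \<in> A \<Longrightarrow> j \<in> A \<Longrightarrow> gsrc G ` U i = gsrc G ` U j"
    "\<And>i. i \<in> A \<Longrightarrow> exclusive_part A U i \<noteq> {}"
    "\<And>i. i \<in> A \<Longrightarrow> gtop G interior_of exclusive_part A U i = {}"
    "\<And>i. i \<in> A \<Longrightarrow> a i \<noteq> 0"
    "\<And>I. I \<subseteq> A \<Longrightarrow> card I > 1 \<Longrightarrow> (\<Inter>i\<in>I. U i) - (\<Union>j\<in>A - I. U j) \<noteq> {} \<Longrightarrow> (\<Sum>i\<in>I. a i) = 0"
proof -
  define over where "over = (\<lambda>x. \<exists>g\<in>mor G. gsrc G g = x \<and> f g \<noteq> 0)"
  \<comment> \<open>The minimum is taken over all units as well, since merging two bisections moves
    the base point to the source of a common element.\<close>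
  define Q where "Q = (\<lambda>k. \<exists>x A W V F. card A = k \<and> local_form f x A W V F \<and> over x)"
  have "\<exists>k. Q k"
    using lf[OF src_in_units[OF nonzero(1)]] nonzero unfolding Q_def over_def by blast
  define k where "k = (LEAST k. Q k)"
  have "Q k" and min: "\<And>m. Q m \<Longrightarrow> k \<le> m"
    unfolding k_def using \<open>\<exists>k. Q k\<close> by (auto intro: LeastI_ex Least_le)
  then obtain x B W V F where B: "card B = k" "local_form f x B W V F" and over_x: "over x"
    unfolding Q_def by blast
  have fin: "finite B" and W: "openin (unit_space G) W" "x \<in> W"
    and V: "\<And>k. k \<in> B \<Longrightarrow> open_bisection G (V k)" "\<And>k. k \<in> B \<Longrightarrow> gsrc G ` V k = W"
    and f: "\<And>g. g \<in> mor G \<Longrightarrow> gsrc G g \<in> W \<Longrightarrow> f g = (\<Sum>i\<in>{i\<in>B. g \<in> V i}. F i (gsrc G g))"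
    and F: "\<And>I. I \<subseteq> B \<Longrightarrow> openin (unit_space G) {y\<in>W. (\<Sum>i\<in>I. F i y) \<noteq> 0}"
    using B(2) unfolding local_form_def by blast+
  \<comment> \<open>A common element \<open>h\<close> would give a local form at
    \<open>gsrc G h\<close> with one bisection fewer, and \<open>over (gsrc G h)\<close> makes it a
    competitor in the minimum.\<close>
  have disj: "i = j" if ij: "i \<in> B" "j \<in> B" and h: "h \<in> V i" "h \<in> V j" and o: "over (gsrc G h)" for i j h
  proof (rule ccontr)
    assume "i \<noteq> j"
    then have "Q (card (B - {j}))"
      using local_form_merge[OF B(2) ij _ h] o unfolding Q_def by blast
    then have "k \<le> card (B - {j})" by (rule min)
    moreover have "card (B - {j}) < card B" using fin ij by (intro card_Diff1_less)
    ultimately show False using B(1) by simp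
  qed
  define a where "a = (\<lambda>i. F i x)"
  define A where "A = {i \<in> B. a i \<noteq> 0}"
  \<comment> \<open>Each of the finitely many partial sums that is nonzero at \<open>x\<close> stays
    nonzero over \<open>W'\<close>. Hence a zero of \<open>f\<close> above \<open>W'\<close> yields
    a relation between the values at \<open>x\<close> itself.\<close>
  define W' where "W' = W \<inter> (\<Inter>I\<in>{I \<in> Pow B. (\<Sum>i\<in>I. a i) \<noteq> 0}. {y\<in>W. (\<Sum>i\<in>I. F i y) \<noteq> 0})"
  define U where "U = (\<lambda>i. {g \<in> V i. gsrc G g \<in> W'})"
  define \<W> where "\<W> = insert W ((\<lambda>I. {y\<in>W. (\<Sum>i\<in>I. F i y) \<noteq> 0}) ` {I \<in> Pow B. (\<Sum>i\<in>I. a i) \<noteq> 0})"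
  have "openin (unit_space G) (\<Inter>\<W>)"
    using W F fin by (intro openin_Inter) (auto simp: \<W>_def)
  moreover have "\<Inter>\<W> = W'" by (auto simp: \<W>_def W'_def)
  ultimately have W': "openin (unit_space G) W'" by simp
  have xW': "x \<in> W'" using W by (auto simp: W'_def a_def)
  have W'W: "W' \<subseteq> W" by (auto simp: W'_def)
  have shrunk: "(\<Sum>i\<in>I. F i y) \<noteq> 0" if "y \<in> W'" "I \<subseteq> B" "(\<Sum>i\<in>I. a i) \<noteq> 0" for y I
    using that by (auto simp: W'_def)
  have V_mor: "h \<in> mor G" if "h \<in> V i" "i \<in> B" for h i
    using open_bisection_subset[OF V(1)] that by blast
  have nz: "f h \<noteq> 0" if "h \<in> mor G" "gsrc G h \<in> W'" "(\<Sum>i\<in>{i\<in>B. h \<in> V i}. a i) \<noteq> 0" for h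
    using f[of h] shrunk[of "gsrc G h" "{i\<in>B. h \<in> V i}"] that W'W by auto
  have restrict: "(\<Sum>i\<in>{i\<in>B. h \<in> V i}. a i) = (\<Sum>i\<in>{i\<in>A. h \<in> U i}. a i)" if "gsrc G h \<in> W'" for h
    using fin that by (intro sum.mono_neutral_right) (auto simp: A_def U_def)
  \<comment> \<open>At such a point the sum of the values reduces to \<open>a i\<close>, which is
    nonzero because indices with vanishing value were discarded.\<close>
  have excl: "exclusive_part A U i \<subseteq> osupp G f" if i: "i \<in> A" for i
  proof
    fix h assume h: "h \<in> exclusive_part A U i"
    then have "{j\<in>A. h \<in> U j} = {i}" "gsrc G h \<in> W'" "h \<in> mor G"
      using i V_mor by (auto simp: exclusive_part_def U_def A_def)
    then show "h \<in> osupp G f"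
      using nz restrict i by (auto simp: osupp_def A_def)
  qed
  have "A \<noteq> {}"
  proof
    assume "A = {}"
    then have "\<And>i. i \<in> B \<Longrightarrow> F i x = 0" by (auto simp: A_def a_def)
    moreover obtain g where "g \<in> mor G" "gsrc G g = x" "f g \<noteq> 0" using over_x unfolding over_def by blast
    ultimately show False using f[of g] W(2) by auto
  qed
  moreover have "open_bisection G (U i)" if "i \<in> A" for i
    using V W' that by (simp add: U_def A_def open_bisection_restrict)
  moreover have "gsrc G ` U i = W'" if "i \<in> A" for i
    using V(2)[of i] W'W that by (auto simp: U_def A_def)
  moreover have "exclusive_part A U i \<noteq> {}" if i: "i \<in> A" for i
  proof -
    have "x \<in> gsrc G ` V i" using i W(2) V(2) by (auto simp: A_def)
    then obtain g where g: "g \<in> V i" "gsrc G g = x" by blast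
    \<comment> \<open>As \<open>f\<close> does not vanish over \<open>x\<close>, the bisections are
      disjoint there, so the point of \<open>V i\<close> above \<open>x\<close> lies in no
      other.\<close>
    have "g \<notin> U j" if "j \<in> A" "j \<noteq> i" for j
      using disj[of i j g] that i g over_x by (auto simp: U_def A_def)
    then have "g \<in> exclusive_part A U i" using g xW' by (auto simp: exclusive_part_def U_def)
    then show ?thesis by blast
  qed
  moreover have "gtop G interior_of exclusive_part A U i = {}" if i: "i \<in> A" for i
    using interior_of_mono[OF excl[OF i]] singular by blast
  moreover have "(\<Sum>i\<in>I. a i) = 0"
    if I: "I \<subseteq> A" "card I > 1" "(\<Inter>i\<in>I. U i) - (\<Union>j\<in>A - I. U j) \<noteq> {}" for I
  proof (rule ccontr)
    assume neq: "(\<Sum>i\<in>I. a i) \<noteq> 0"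
    obtain h where h: "h \<in> (\<Inter>i\<in>I. U i) - (\<Union>j\<in>A - I. U j)" using I(3) by blast
    obtain i j where ij: "i \<in> I" "j \<in> I" "i \<noteq> j" 
      using I(2) card_le_Suc0_iff_eq[of I] card_ge_0_finite[of I] by force
    have hU: "h \<in> U i" "h \<in> U j" using h ij by auto
    have hW: "gsrc G h \<in> W'" "h \<in> mor G" using hU V_mor ij I(1) by (auto simp: U_def A_def)
    have "{i\<in>A. h \<in> U i} = I" using h I(1) by auto
    \<comment> \<open>A nonzero value at an element shared by two bisections contradicts
      minimality.\<close>
    then have "f h \<noteq> 0" using nz[OF hW(2,1)] restrict[OF hW(1)] neq by simp
    then have "over (gsrc G h)" using hW unfolding over_def by blast
    then have "i = j" using disj[of i j h] hU ij I(1) by (auto simp: U_def A_def)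
    then show False using ij by simp
  qed
  moreover have "finite A" "\<And>i. i \<in> A \<Longrightarrow> a i \<noteq> 0" using fin by (auto simp: A_def)
  ultimately show thesis using that[of A U a] by simp
qed

text \<open>The index set left by minimality is renumbered as \<open>{1..n}\<close>;
  \<open>relation_imp_not_generated\<close> then produces the order \<open>t\<close> from the values
  at the chosen unit.\<close>

lemma singular_imp_condition_S:
  fixes f :: "'a \<Rightarrow> 'r::ring"
  assumes lf: "\<And>x. x \<in> units G \<Longrightarrow> \<exists>A W V F. local_form f x A W V F"
    and nonzero: "g1 \<in> mor G" "f g1 \<noteq> 0"
    and singular: "gtop G interior_of osupp G f = {}"
  shows "\<exists>t \<in> ring_ords TYPE('r). condition_S t G"
proof -
  obtain A U and a :: "nat \<Rightarrow> 'r" where A: "finite A" "A \<noteq> {}"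
    and U: "\<And>i. i \<in> A \<Longrightarrow> open_bisection G (U i)"
      "\<And>i j. i \<in> A \<Longrightarrow> j \<in> A \<Longrightarrow> gsrc G ` U i = gsrc G ` U j"
      "\<And>i. i \<in> A \<Longrightarrow> exclusive_part A U i \<noteq> {}"
      "\<And>i. i \<in> A \<Longrightarrow> gtop G interior_of exclusive_part A U i = {}"
    and a: "\<And>i. i \<in> A \<Longrightarrow> a i \<noteq> 0"
      "\<And>I. I \<subseteq> A \<Longrightarrow> card I > 1 \<Longrightarrow> (\<Inter>i\<in>I. U i) - (\<Union>j\<in>A - I. U j) \<noteq> {} \<Longrightarrow> (\<Sum>i\<in>I. a i) = 0"
    by (rule local_form_imp_relation[OF _ nonzero singular], erule lf) (rule that; assumption)
  define n where "n = card A"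
  obtain e where e: "bij_betw e {1..n} A"
    using ex_bij_betw_nat_finite_1[OF A(1)] by (auto simp: n_def)
  have e_img: "e ` ({1..n} - I) = A - e ` I" if "I \<subseteq> {1..n}" for I
    using e that by (simp add: bij_betw_def inj_on_image_set_diff[of e "{1..n}"])
  have eA: "e i \<in> A" if "i \<in> {1..n}" for i using e that by (auto simp: bij_betw_def)
  have n: "n > 0" using A by (simp add: n_def card_gt_0_iff)
  have excl: "exclusive_part {1..n} (U \<circ> e) i = exclusive_part A U (e i)" if "i \<in> {1..n}" for i
    unfolding exclusive_part_def using e_img[of "{i}"] that
    by (simp add: image_image[symmetric] flip: image_comp)
  have "(\<Sum>i\<in>I. (a \<circ> e) i) = 0" if I: "I \<in> realised_sets n (U \<circ> e)" for I
  proof -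
    have sub: "I \<subseteq> {1..n}" "card I > 1"
      and ne: "(\<Inter>i\<in>I. (U \<circ> e) i) - (\<Union>j\<in>{1..n} - I. (U \<circ> e) j) \<noteq> {}"
      using I by (auto simp: realised_sets_def)
    have inj: "inj_on e I" using e sub(1) inj_on_subset by (auto simp: bij_betw_def)
    have "(\<Inter>i\<in>e ` I. U i) - (\<Union>j\<in>A - e ` I. U j) \<noteq> {}"
      unfolding e_img[OF sub(1), symmetric] image_comp by (rule ne)
    moreover have "e ` I \<subseteq> A" using sub(1) eA by blast
    moreover have "card (e ` I) > 1" using inj sub(2) by (simp add: card_image)
    ultimately have "(\<Sum>i\<in>e ` I. a i) = 0" by (intro a(2))
    then show ?thesis using inj by (simp add: sum.reindex)
  qed
  moreover have "(a \<circ> e) 1 \<noteq> 0" "1 \<in> {1..n}" using a(1) eA n by auto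
  ultimately obtain t j where t: "t \<in> ring_ords TYPE('r)"
    and j: "j \<in> {1..n}" "\<not> generated t n (realised_sets n (U \<circ> e)) j"
    using relation_imp_not_generated[of 1 n "a \<circ> e" "realised_sets n (U \<circ> e)"]
    by (auto simp: realised_sets_def)
  have "t \<noteq> 1" using t add_ord_eq_1_iff by (auto simp: ring_ords_def)
  have "condition_S t G"
    unfolding condition_S_iff[OF \<open>t \<noteq> 1\<close>]
  proof (intro exI[of _ n] exI[of _ "U \<circ> e"] conjI ballI bexI[of _ j])
    fix i assume i: "i \<in> {1..n}"
    show "open_bisection G ((U \<circ> e) i)" using U(1) eA[OF i] by simp
    show "exclusive_part {1..n} (U \<circ> e) i \<noteq> {}"
      "gtop G interior_of exclusive_part {1..n} (U \<circ> e) i = {}"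
      using U(3,4)[OF eA[OF i]] excl[OF i] by simp_all
    fix i' assume "i' \<in> {1..n}"
    then show "gsrc G ` (U \<circ> e) i = gsrc G ` (U \<circ> e) i'" using U(2) eA i by simp
  qed (use n j in auto)
  with t show ?thesis by blast
qed

end

section \<open>The regular representation\<close>

lemma ell2_0 [simp]: "(\<lambda>g. 0) \<in> ell2 A"
  by (simp add: ell2_def)

lemma ell2_norm_0 [simp]: "ell2_norm A (\<lambda>g. 0) = 0"
  by (simp add: ell2_norm_def)

lemma ell2_vanish: "\<xi> \<in> ell2 A \<Longrightarrow> g \<notin> A \<Longrightarrow> \<xi> g = 0"
  by (simp add: ell2_def)

lemma ell2_summable: "\<xi> \<in> ell2 A \<Longrightarrow> (\<lambda>g. (cmod (\<xi> g))\<^sup>2) summable_on A"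
  by (simp add: ell2_def)

lemma ell2_norm_nonneg: "0 \<le> ell2_norm A \<xi>"
  by (simp add: ell2_norm_def infsum_nonneg)

lemma ell2_norm_square: "(ell2_norm A \<xi>)\<^sup>2 = (\<Sum>\<^sub>\<infinity>g\<in>A. (cmod (\<xi> g))\<^sup>2)"
  by (simp add: ell2_norm_def infsum_nonneg)

text \<open>Boundedness tolerates any constant, so instead of Minkowski's inequality it is enough
  that \<open>(a + b)^2\<close> is at most \<open>2 a^2 + 2 b^2\<close>; this is where the factor 2
  comes from.\<close>

lemma ell2_add:
  assumes "\<xi> \<in> ell2 A" "\<eta> \<in> ell2 A"
  shows "(\<lambda>g. \<xi> g + \<eta> g) \<in> ell2 A"
    and "ell2_norm A (\<lambda>g. \<xi> g + \<eta> g) \<le> 2 * (ell2_norm A \<xi> + ell2_norm A \<eta>)"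
proof -
  note s = ell2_summable[OF assms(1)] ell2_summable[OF assms(2)]
  have le: "(cmod (x + y))\<^sup>2 \<le> 2 * (cmod x)\<^sup>2 + 2 * (cmod y)\<^sup>2" for x y :: complex
  proof -
    have "(cmod (x + y))\<^sup>2 \<le> (cmod x + cmod y)\<^sup>2"
      by (intro power_mono norm_triangle_ineq) simp
    moreover have "0 \<le> (cmod x - cmod y)\<^sup>2" by simp
    ultimately show ?thesis by (simp add: power2_sum power2_diff)
  qed
  have s2: "(\<lambda>g. 2 * (cmod (\<xi> g))\<^sup>2 + 2 * (cmod (\<eta> g))\<^sup>2) summable_on A"
    using s by (intro summable_on_add summable_on_cmult_right)
  then have s3: "(\<lambda>g. (cmod (\<xi> g + \<eta> g))\<^sup>2) summable_on A"
    by (rule summable_on_comparison_test) (use le in auto)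
  then show "(\<lambda>g. \<xi> g + \<eta> g) \<in> ell2 A" using assms by (auto simp: ell2_def)
  have "(ell2_norm A (\<lambda>g. \<xi> g + \<eta> g))\<^sup>2 \<le> (\<Sum>\<^sub>\<infinity>g\<in>A. 2 * (cmod (\<xi> g))\<^sup>2 + 2 * (cmod (\<eta> g))\<^sup>2)"
    unfolding ell2_norm_square using s3 s2 le by (rule infsum_mono)
  also have "\<dots> = 2 * (ell2_norm A \<xi>)\<^sup>2 + 2 * (ell2_norm A \<eta>)\<^sup>2"
    using s by (simp add: ell2_norm_square infsum_add summable_on_cmult_right infsum_cmult_right')
  also have "\<dots> \<le> (2 * (ell2_norm A \<xi> + ell2_norm A \<eta>))\<^sup>2"
    using ell2_norm_nonneg[of A \<xi>] ell2_norm_nonneg[of A \<eta>] by (simp add: power2_eq_square algebra_simps)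
  finally show "ell2_norm A (\<lambda>g. \<xi> g + \<eta> g) \<le> 2 * (ell2_norm A \<xi> + ell2_norm A \<eta>)"
    by (rule power2_le_imp_le) (simp add: ell2_norm_nonneg)
qed

lemma ell2_scale: "\<xi> \<in> ell2 A \<Longrightarrow> (\<lambda>g. a * \<xi> g) \<in> ell2 A"
  unfolding ell2_def by (auto simp: norm_mult power_mult_distrib intro: summable_on_cmult_right)

section \<open>Functions with compact support on a bisection\<close>

lemma Cc_on_compact:
  assumes "f \<in> Cc_on G U" "U \<subseteq> mor G"
  shows "\<exists>K. compactin (gtop G) K \<and> K \<subseteq> U \<and> (\<forall>g. g \<notin> K \<longrightarrow> f g = 0)"
proof -
  let ?K = "subtopology (gtop G) U closure_of {g \<in> U. f g \<noteq> 0}"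
  have "compactin (gtop G) ?K" "?K \<subseteq> U"
    using assms(1) by (simp_all add: Cc_on_def compactin_subtopology)
  moreover have "{g \<in> U. f g \<noteq> 0} \<subseteq> ?K"
    using assms(2) by (intro closure_of_subset) (auto simp: mor_def)
  then have "\<forall>g. g \<notin> ?K \<longrightarrow> f g = 0" using assms(1) by (auto simp: Cc_on_def)
  ultimately show ?thesis by blast
qed

lemma Cc_on_bounded:
  assumes "f \<in> Cc_on G U" "U \<subseteq> mor G"
  shows "\<exists>B. \<forall>g. cmod (f g) \<le> B"
proof -
  obtain K where K: "compactin (gtop G) K" "K \<subseteq> U" "\<And>g. g \<notin> K \<Longrightarrow> f g = 0"
    using Cc_on_compact[OF assms] by blast
  have "compactin (subtopology (gtop G) U) K" using K by (simp add: compactin_subtopology)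
  then have "compact (f ` K)"
    using image_compactin[of "subtopology (gtop G) U" K euclidean f] assms(1)
    by (simp add: Cc_on_def)
  then have "bounded (f ` K)" by (rule compact_imp_bounded)
  then obtain B where B: "\<And>g. g \<in> K \<Longrightarrow> cmod (f g) \<le> B" by (auto simp: bounded_iff)
  then have "cmod (f g) \<le> max B 0" for g
    using K(3)[of g] B[of g] by (cases "g \<in> K") (auto simp: le_max_iff_disj)
  then show ?thesis by blast
qed

section \<open>Convolution operators on the source fibres\<close>

context etale_groupoid
begin

text \<open>A factorisation of \<open>g\<close> is determined by its first factor \<open>k\<close>.
  The finite set \<open>S\<close> may exceed the support of \<open>f\<close>, so the union of the
  fibres of several bisections can be used for a sum of functions.\<close>

lemma convolution_eq_sum:
  assumes S: "finite S" "S \<subseteq> {k \<in> mor G. grng G k = grng G g}" and g: "g \<in> mor G"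
    and f: "\<And>k. k \<in> mor G \<Longrightarrow> grng G k = grng G g \<Longrightarrow> k \<notin> S \<Longrightarrow> f k = 0"
  shows "convolution G f \<xi> g = (\<Sum>k\<in>S. f k * \<xi> (gmult G (ginv G k) g))"
proof -
  let ?P = "{(g1, g2) \<in> composable G. gmult G g1 g2 = g \<and> f g1 \<noteq> 0 \<and> \<xi> g2 \<noteq> 0}"
  let ?T = "{k \<in> S. f k \<noteq> 0 \<and> \<xi> (gmult G (ginv G k) g) \<noteq> 0}"
  have "?P = (\<lambda>k. (k, gmult G (ginv G k) g)) ` ?T"
  proof (rule Set.set_eqI, rule iffI)
    fix p assume "p \<in> ?P"
    then obtain g1 g2 where p: "p = (g1, g2)" "(g1, g2) \<in> composable G" "gmult G g1 g2 = g"
      "f g1 \<noteq> 0" "\<xi> g2 \<noteq> 0" by auto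
    then have "g2 = gmult G (ginv G g1) g" using inv_mult_cancel[OF p(2)] by simp
    moreover have "g1 \<in> mor G" "grng G g1 = grng G g"
      using p rng_mult by (auto simp: composable_def)
    ultimately show "p \<in> (\<lambda>k. (k, gmult G (ginv G k) g)) ` ?T" using p f by blast
  next
    fix p assume "p \<in> (\<lambda>k. (k, gmult G (ginv G k) g)) ` ?T"
    then obtain k where k: "k \<in> S" "f k \<noteq> 0" "\<xi> (gmult G (ginv G k) g) \<noteq> 0"
      "p = (k, gmult G (ginv G k) g)" by blast
    then have km: "k \<in> mor G" "grng G k = grng G g" using S by auto
    then have "(ginv G k, g) \<in> composable G" using g by (auto simp: composable_def inv_closed src_inv)
    then have "(k, gmult G (ginv G k) g) \<in> composable G"
      using km by (auto simp: composable_def mult_closed rng_mult rng_inv)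
    then show "p \<in> ?P" using k mult_inv_cancel[OF km(1) g km(2)] by auto
  qed
  then have "convolution G f \<xi> g = (\<Sum>(g1, g2)\<in>(\<lambda>k. (k, gmult G (ginv G k) g)) ` ?T. f g1 * \<xi> g2)"
    by (simp add: convolution_def)
  also have "\<dots> = (\<Sum>k\<in>?T. f k * \<xi> (gmult G (ginv G k) g))"
    by (subst sum.reindex) (auto simp: inj_on_def)
  also have "\<dots> = (\<Sum>k\<in>S. f k * \<xi> (gmult G (ginv G k) g))"
    using S(1) by (intro sum.mono_neutral_left) auto
  finally show ?thesis .
qed

lemma convolution_outside:
  assumes "g \<notin> mor G"
  shows "convolution G f \<xi> g = 0"
proof -
  have none: "{(g1, g2) \<in> composable G. gmult G g1 g2 = g \<and> f g1 \<noteq> 0 \<and> \<xi> g2 \<noteq> 0} = {}"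
    using mult_closed assms by auto
  show ?thesis unfolding convolution_def none by simp
qed

lemma bisection_fibre:
  assumes "open_bisection G U"
  shows "finite {k \<in> U. grng G k = y}"
proof (cases "\<exists>k\<in>U. grng G k = y")
  case True
  then obtain k0 where "k0 \<in> U" "grng G k0 = y" by blast
  then have "{k \<in> U. grng G k = y} \<subseteq> {k0}"
    using assms by (auto simp: open_bisection_def inj_on_def)
  then show ?thesis by (rule finite_subset) simp
next
  case False
  then have "{k \<in> U. grng G k = y} = {}" by blast
  then show ?thesis by (simp only: finite.emptyI)
qed

lemma convolution_Cc:
  fixes a :: "nat \<Rightarrow> complex"
  assumes U: "\<And>i. i < n \<Longrightarrow> open_bisection G (U i)"
    and p: "\<And>i g. i < n \<Longrightarrow> g \<notin> U i \<Longrightarrow> p i g = 0"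
    and f: "f = (\<lambda>g. \<Sum>i<n. a i * p i g)" and g: "g \<in> mor G"
  shows "convolution G f \<xi> g
    = (\<Sum>i<n. \<Sum>k\<in>{k \<in> U i. grng G k = grng G g}. a i * p i k * \<xi> (gmult G (ginv G k) g))"
proof -
  define S where "S = (\<Union>i<n. {k \<in> U i. grng G k = grng G g})"
  have S: "finite S" "S \<subseteq> {k \<in> mor G. grng G k = grng G g}"
    unfolding S_def using bisection_fibre[OF U] open_bisection_subset[OF U] by auto
  have "f k = 0" if "k \<in> mor G" "grng G k = grng G g" "k \<notin> S" for k
    using that p by (auto simp: S_def f intro!: sum.neutral)
  then have "convolution G f \<xi> g = (\<Sum>k\<in>S. f k * \<xi> (gmult G (ginv G k) g))"
    using convolution_eq_sum[OF S g] by blast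
  also have "\<dots> = (\<Sum>i<n. \<Sum>k\<in>S. a i * p i k * \<xi> (gmult G (ginv G k) g))"
    by (subst sum.swap) (simp add: f sum_distrib_right)
  also have "\<dots> = (\<Sum>i<n. \<Sum>k\<in>{k \<in> U i. grng G k = grng G g}. a i * p i k * \<xi> (gmult G (ginv G k) g))"
    using S(1) p by (intro sum.cong refl sum.mono_neutral_right) (auto simp: S_def)
  finally show ?thesis .
qed

text \<open>A function on a bisection acts by weighted translations: at most one \<open>k \<in> U\<close> has the range of
  \<open>g\<close>, and the partial map \<open>g \<mapsto> k\<^sup>-\<^sup>1 g\<close> is injective.\<close>

lemma translate_ell2:
  assumes U: "open_bisection G U" and p: "\<And>g. g \<notin> U \<Longrightarrow> p g = 0" and B: "\<And>g. cmod (p g) \<le> B"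
    and \<xi>: "\<xi> \<in> ell2 (src_fibre G x)"
  defines "T \<equiv> \<lambda>g. if g \<in> mor G
    then \<Sum>k\<in>{k \<in> U. grng G k = grng G g}. p k * \<xi> (gmult G (ginv G k) g) else 0"
  shows "T \<in> ell2 (src_fibre G x)" "ell2_norm (src_fibre G x) T \<le> B * ell2_norm (src_fibre G x) \<xi>"
proof -
  let ?X = "src_fibre G x"
  have B0: "0 \<le> B" using B[of undefined] norm_ge_zero order_trans by blast
  define D where "D = {g \<in> ?X. \<exists>k\<in>U. grng G k = grng G g}"
  define \<kappa> where "\<kappa> = (\<lambda>g. SOME k. k \<in> U \<and> grng G k = grng G g)"
  define \<tau> where "\<tau> = (\<lambda>g. gmult G (ginv G (\<kappa> g)) g)"
  have \<kappa>: "\<kappa> g \<in> U \<and> grng G (\<kappa> g) = grng G g" if "g \<in> D" for g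
  proof -
    have "\<exists>k. k \<in> U \<and> grng G k = grng G g" using that by (auto simp: D_def)
    then show ?thesis unfolding \<kappa>_def by (rule someI_ex)
  qed
  have fib: "{k \<in> U. grng G k = grng G g} = {\<kappa> g}" if "g \<in> D" for g
    using \<kappa>[OF that] U by (auto simp: open_bisection_def inj_on_def)
  have TD: "T g = p (\<kappa> g) * \<xi> (\<tau> g)" if "g \<in> D" for g
    using that by (simp add: T_def fib \<tau>_def D_def src_fibre_def)
  have Tout: "T g = 0" if "g \<in> mor G" "\<not> (\<exists>k\<in>U. grng G k = grng G g)" for g
  proof -
    have none: "{k \<in> U. grng G k = grng G g} = {}" using that by blast
    show ?thesis unfolding T_def none by simp
  qed
  have comp: "(ginv G k, g) \<in> composable G" if "k \<in> U" "grng G k = grng G g" "g \<in> mor G" for k g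
    using that open_bisection_subset[OF U] by (auto simp: composable_def inv_closed src_inv)
  have Tvan: "T g = 0" if "g \<notin> ?X" for g
  proof (cases "g \<in> mor G")
    case True
    have "\<xi> (gmult G (ginv G k) g) = 0" if "k \<in> U" "grng G k = grng G g" for k
      using comp[OF that True] True \<open>g \<notin> ?X\<close> ell2_vanish[OF \<xi>]
      by (auto simp: src_fibre_def src_mult)
    then show ?thesis by (auto simp: T_def intro!: sum.neutral)
  qed (simp add: T_def)
  have DX: "D \<subseteq> ?X" by (auto simp: D_def)
  have \<tau>X: "\<tau> ` D \<subseteq> ?X"
  proof (rule image_subsetI)
    fix g assume g: "g \<in> D"
    then have "g \<in> mor G" "gsrc G g = x" by (auto simp: D_def src_fibre_def)
    with g \<kappa> comp[of "\<kappa> g" g] show "\<tau> g \<in> ?X"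
      by (simp add: \<tau>_def src_fibre_def mult_closed src_mult)
  qed
  \<comment> \<open>The range of \<open>\<tau> g\<close> is the source of \<open>\<kappa> g\<close>.
    As the source is injective on \<open>U\<close>, this determines \<open>\<kappa> g\<close>, and
    \<open>g\<close> is the product of \<open>\<kappa> g\<close> and
    \<open>\<tau> g\<close>.\<close>
  have "inj_on \<tau> D"
  proof (rule inj_onI)
    fix g h assume gh: "g \<in> D" "h \<in> D" "\<tau> g = \<tau> h"
    have m: "g \<in> mor G" "h \<in> mor G" using gh by (auto simp: D_def src_fibre_def)
    have \<kappa>m: "\<kappa> g \<in> mor G" "\<kappa> h \<in> mor G"
      using \<kappa> gh open_bisection_subset[OF U] by blast+
    have "gsrc G (\<kappa> k) = grng G (\<tau> k)" if "k \<in> D" for k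
      using \<kappa>[OF that] that comp[of "\<kappa> k" k] open_bisection_subset[OF U]
      by (auto simp: \<tau>_def rng_mult rng_inv D_def src_fibre_def)
    then have "gsrc G (\<kappa> g) = gsrc G (\<kappa> h)" using gh by simp
    then have "\<kappa> g = \<kappa> h" using U \<kappa> gh by (auto simp: open_bisection_def inj_on_def)
    moreover have "gmult G (\<kappa> k) (\<tau> k) = k" if "k \<in> D" "k \<in> mor G" "\<kappa> k \<in> mor G" for k
      using mult_inv_cancel \<kappa> that by (simp add: \<tau>_def)
    ultimately show "g = h" using gh m \<kappa>m by metis
  qed
  have sum_X: "(\<lambda>g. (cmod (\<xi> g))\<^sup>2) summable_on ?X" using \<xi> by (rule ell2_summable)
  then have "(\<lambda>g. (cmod (\<xi> g))\<^sup>2) summable_on \<tau> ` D"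
    using \<tau>X by (rule summable_on_subset_banach)
  then have sum_D: "(\<lambda>g. (cmod (\<xi> (\<tau> g)))\<^sup>2) summable_on D"
    using summable_on_reindex[OF \<open>inj_on \<tau> D\<close>, of "\<lambda>g. (cmod (\<xi> g))\<^sup>2"] by (simp add: o_def)
  have bound: "(cmod (T g))\<^sup>2 \<le> B\<^sup>2 * (cmod (\<xi> (\<tau> g)))\<^sup>2" if "g \<in> D" for g
    using B by (simp add: TD[OF that] norm_mult power_mult_distrib mult_right_mono power_mono)
  have sum_BD: "(\<lambda>g. B\<^sup>2 * (cmod (\<xi> (\<tau> g)))\<^sup>2) summable_on D"
    using sum_D by (rule summable_on_cmult_right)
  have TX: "(\<lambda>g. (cmod (T g))\<^sup>2) summable_on D"
    using sum_BD bound by (rule summable_on_comparison_test) auto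
  have off: "(cmod (T g))\<^sup>2 = 0" if "g \<in> ?X - D" for g
    using Tout[of g] that by (auto simp: D_def src_fibre_def)
  have TX': "(\<lambda>g. (cmod (T g))\<^sup>2) summable_on ?X"
    using TX off DX by (subst summable_on_cong_neutral[of D ?X _ "\<lambda>g. (cmod (T g))\<^sup>2"]) auto
  then show "T \<in> ell2 ?X" using Tvan by (simp add: ell2_def)
  have "infsum (\<lambda>g. (cmod (T g))\<^sup>2) ?X = infsum (\<lambda>g. (cmod (T g))\<^sup>2) D"
    using off DX by (intro infsum_cong_neutral) auto
  also have "\<dots> \<le> infsum (\<lambda>g. B\<^sup>2 * (cmod (\<xi> (\<tau> g)))\<^sup>2) D"
    using TX sum_BD bound by (rule infsum_mono)
  also have "\<dots> = B\<^sup>2 * infsum (\<lambda>g. (cmod (\<xi> g))\<^sup>2) (\<tau> ` D)"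
    using infsum_reindex[OF \<open>inj_on \<tau> D\<close>, of "\<lambda>g. (cmod (\<xi> g))\<^sup>2"]
    by (simp add: o_def infsum_cmult_right')
  also have "infsum (\<lambda>g. (cmod (\<xi> g))\<^sup>2) (\<tau> ` D) \<le> infsum (\<lambda>g. (cmod (\<xi> g))\<^sup>2) ?X"
    using sum_X \<tau>X summable_on_subset_banach[OF sum_X \<tau>X] by (intro infsum_mono_neutral) auto
  finally have "infsum (\<lambda>g. (cmod (T g))\<^sup>2) ?X \<le> B\<^sup>2 * infsum (\<lambda>g. (cmod (\<xi> g))\<^sup>2) ?X"
    using B0 by (simp add: mult_left_mono)
  then have "sqrt (infsum (\<lambda>g. (cmod (T g))\<^sup>2) ?X) \<le> sqrt (B\<^sup>2 * infsum (\<lambda>g. (cmod (\<xi> g))\<^sup>2) ?X)"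
    by (rule real_sqrt_le_mono)
  then show "ell2_norm ?X T \<le> B * ell2_norm ?X \<xi>"
    using B0 by (simp add: ell2_norm_def real_sqrt_mult)
qed

text \<open>Each use of \<open>ell2_add\<close> doubles the constants accumulated so far, whence the
  powers of 2.\<close>

lemma bounded_operator_sum:
  assumes "\<And>i. i < (n::nat) \<Longrightarrow> T i \<in> ell2 A"
    and "\<And>i. i < n \<Longrightarrow> ell2_norm A (T i) \<le> B i * c"
  shows "(\<lambda>g. \<Sum>i<n. T i g) \<in> ell2 A \<and>
    ell2_norm A (\<lambda>g. \<Sum>i<n. T i g) \<le> (\<Sum>i<n. 2 ^ (n - i) * B i) * c"
  using assms
proof (induction n)
  case (Suc n)
  let ?S = "\<lambda>g. \<Sum>i<n. T i g"
  have IH: "?S \<in> ell2 A" "ell2_norm A ?S \<le> (\<Sum>i<n. 2 ^ (n - i) * B i) * c" using Suc by auto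
  have "ell2_norm A (\<lambda>g. ?S g + T n g) \<le> 2 * (ell2_norm A ?S + ell2_norm A (T n))"
    using IH Suc.prems by (intro ell2_add(2)) auto
  also have "\<dots> \<le> 2 * ((\<Sum>i<n. 2 ^ (n - i) * B i) * c + B n * c)"
    using IH(2) Suc.prems(2)[of n] by simp
  also have "\<dots> = (\<Sum>i<Suc n. 2 ^ (Suc n - i) * B i) * c"
    by (simp add: algebra_simps sum_distrib_left Suc_diff_le)
  finally show ?case using ell2_add(1)[OF IH(1) Suc.prems(1)[of n]] by simp
qed simp

lemma regular_rep_bounded:
  assumes f: "f \<in> Cc G" and x: "x \<in> units G"
  shows "regular_rep G f x \<in> bounded_operators (src_fibre G x)"
proof -
  let ?X = "src_fibre G x"
  obtain n :: nat and a p where f_eq: "f = (\<lambda>g. \<Sum>i<n. a i * p i g)"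
    and "\<forall>i<n. \<exists>U. open_bisection G U \<and> p i \<in> Cc_on G U"
    using f unfolding Cc_def by blast
  then obtain U where U: "\<And>i. i < n \<Longrightarrow> open_bisection G (U i)"
    and p: "\<And>i. i < n \<Longrightarrow> p i \<in> Cc_on G (U i)" by metis
  have p0: "p i g = 0" if "i < n" "g \<notin> U i" for i g using p that by (simp add: Cc_on_def)
  obtain B where B: "\<And>i g. i < n \<Longrightarrow> cmod (p i g) \<le> B i"
    using Cc_on_bounded[OF p open_bisection_subset[OF U]] by metis
  define T where "T = (\<lambda>i \<xi> g. if g \<in> mor G
    then \<Sum>k\<in>{k \<in> U i. grng G k = grng G g}. a i * p i k * \<xi> (gmult G (ginv G k) g) else 0)"
  have conv: "convolution G f \<xi> = (\<lambda>g. \<Sum>i<n. T i \<xi> g)" for \<xi>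
  proof
    fix g show "convolution G f \<xi> g = (\<Sum>i<n. T i \<xi> g)"
    proof (cases "g \<in> mor G")
      case True
      then have "convolution G f \<xi> g
        = (\<Sum>i<n. \<Sum>k\<in>{k \<in> U i. grng G k = grng G g}. a i * p i k * \<xi> (gmult G (ginv G k) g))"
        by (intro convolution_Cc[OF _ _ f_eq] U p0)
      with True show ?thesis by (simp only: T_def if_True)
    qed (simp add: T_def convolution_outside)
  qed
  have T: "T i \<xi> \<in> ell2 ?X" "ell2_norm ?X (T i \<xi>) \<le> (cmod (a i) * B i) * ell2_norm ?X \<xi>"
    if "i < n" "\<xi> \<in> ell2 ?X" for i \<xi>
    using translate_ell2[of "U i" "\<lambda>k. a i * p i k" "cmod (a i) * B i" \<xi> x] U p0 B that
    by (simp_all add: T_def norm_mult mult_left_mono)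
  have bdd: "convolution G f \<xi> \<in> ell2 ?X"
    "ell2_norm ?X (convolution G f \<xi>) \<le> (\<Sum>i<n. 2 ^ (n - i) * (cmod (a i) * B i)) * ell2_norm ?X \<xi>"
    if "\<xi> \<in> ell2 ?X" for \<xi>
    using bounded_operator_sum[of n "\<lambda>i. T i \<xi>" ?X "\<lambda>i. cmod (a i) * B i" "ell2_norm ?X \<xi>"] T that
    by (simp_all add: conv)
  have "T i (\<lambda>g. \<xi> g + \<eta> g) g = T i \<xi> g + T i \<eta> g" for i \<xi> \<eta> g
    by (simp add: T_def distrib_left sum.distrib)
  then have add: "convolution G f (\<lambda>g. \<xi> g + \<eta> g) = (\<lambda>g. convolution G f \<xi> g + convolution G f \<eta> g)"
    for \<xi> \<eta>
    by (simp add: conv sum.distrib)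
  have "T i (\<lambda>g. c * \<xi> g) g = c * T i \<xi> g" for i c \<xi> g
    by (simp add: T_def sum_distrib_left mult.left_commute)
  then have scale: "convolution G f (\<lambda>g. c * \<xi> g) = (\<lambda>g. c * convolution G f \<xi> g)" for c \<xi>
    by (simp add: conv sum_distrib_left)
  have rep: "regular_rep G f x = (\<lambda>\<xi>\<in>ell2 ?X. convolution G f \<xi>)"
    using x by (simp add: regular_rep_def)
  show ?thesis
    unfolding rep bounded_operators_def
  proof (intro CollectI conjI ballI allI)
    show "(\<lambda>\<xi>\<in>ell2 ?X. convolution G f \<xi>) \<in> ell2 ?X \<rightarrow>\<^sub>E ell2 ?X" using bdd(1) by auto
    show "\<exists>C. \<forall>\<xi>\<in>ell2 ?X. ell2_norm ?X ((\<lambda>\<xi>\<in>ell2 ?X. convolution G f \<xi>) \<xi>) \<le> C * ell2_norm ?X \<xi>"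
      using bdd(2) by (intro exI ballI) simp
  qed (simp_all add: ell2_add ell2_scale add scale)
qed

text \<open>\<open>f\<close> approximates its own image at distance 0, so only boundedness of the
  operators is at stake.\<close>

lemma regular_rep_in_reduced_Cstar:
  assumes f: "f \<in> Cc G"
  shows "regular_rep G f \<in> reduced_Cstar G"
proof -
  have "family_norm G (\<lambda>x \<xi> g. regular_rep G f x \<xi> g - regular_rep G f x \<xi> g) = 0"
    unfolding family_norm_def op_norm_def by (simp add: SUP_eq_iff bot_ennreal[symmetric])
  moreover have "regular_rep G f \<in> (\<Pi>\<^sub>E x \<in> units G. bounded_operators (src_fibre G x))"
    using regular_rep_bounded[OF f] by (auto simp: regular_rep_def PiE_def extensional_def)
  ultimately show ?thesis
    unfolding reduced_Cstar_def using f by (auto intro!: bexI[of _ f])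
qed

lemma convolution_delta:
  assumes "g \<in> mor G"
  shows "convolution G f (delta (gsrc G g)) g = f g"
proof -
  have "{(g1, g2) \<in> composable G. gmult G g1 g2 = g \<and> f g1 \<noteq> 0 \<and> delta (gsrc G g) g2 \<noteq> 0}
    = (if f g \<noteq> 0 then {(g, gsrc G g)} else {})"
  proof (rule Set.set_eqI, rule iffI)
    fix q assume "q \<in> {(g1, g2) \<in> composable G. gmult G g1 g2 = g \<and> f g1 \<noteq> 0 \<and> delta (gsrc G g) g2 \<noteq> 0}"
    then obtain g1 where q: "q = (g1, gsrc G g)" "(g1, gsrc G g) \<in> composable G"
      "gmult G g1 (gsrc G g) = g" "f g1 \<noteq> 0"
      by (auto simp: delta_def split: if_splits)
    then have "gsrc G g1 = gsrc G g" "g1 \<in> mor G" using assms by (auto simp: composable_def rng_src)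
    then have "g1 = g" using q(3) mult_src by metis
    then show "q \<in> (if f g \<noteq> 0 then {(g, gsrc G g)} else {})" using q by simp
  next
    fix q assume "q \<in> (if f g \<noteq> 0 then {(g, gsrc G g)} else {})"
    then show "q \<in> {(g1, g2) \<in> composable G. gmult G g1 g2 = g \<and> f g1 \<noteq> 0 \<and> delta (gsrc G g) g2 \<noteq> 0}"
      using assms by (auto simp: composable_def src_closed rng_src mult_src delta_def split: if_splits)
  qed
  then show ?thesis by (simp add: convolution_def delta_def)
qed

text \<open>The only factorisation of \<open>g\<close> with second factor \<open>gsrc G g\<close> is
  the trivial one, and pairing with \<open>delta g\<close> reads off its contribution. Thus the
  support of \<open>f\<close> can be computed from its operators.\<close>

lemma as_function_regular_rep:
  assumes g: "g \<in> mor G"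
  shows "as_function G (regular_rep G f) g = f g"
proof -
  let ?x = "gsrc G g"
  have "delta ?x \<in> ell2 (src_fibre G ?x)"
  proof -
    have "(\<lambda>h. (cmod (delta ?x h))\<^sup>2) summable_on (src_fibre G ?x)"
      by (rule finite_nonzero_values_imp_summable_on)
        (rule finite_subset[of _ "{?x}"], auto simp: delta_def)
    then show ?thesis using g by (auto simp: ell2_def delta_def src_fibre_def src_closed src_src)
  qed
  then have "regular_rep G f ?x (delta ?x) = convolution G f (delta ?x)"
    using g by (simp add: regular_rep_def src_in_units)
  moreover have "(\<Sum>\<^sub>\<infinity>h\<in>src_fibre G ?x. convolution G f (delta ?x) h * cnj (delta g h))
    = (\<Sum>\<^sub>\<infinity>h\<in>{g}. convolution G f (delta ?x) h * cnj (delta g h))"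
    using g by (intro infsum_cong_neutral) (auto simp: delta_def src_fibre_def)
  ultimately show ?thesis
    using g convolution_delta[OF g] by (simp add: as_function_def ell2_inner_def delta_def)
qed

end

section \<open>Singular elements from linear relations\<close>

text \<open>The set of indices through \<open>g\<close> is realised as soon as it has two elements,
  and then its sum vanishes, as does the empty sum; only singletons remain.\<close>

lemma sum_realised:
  assumes rel: "\<And>I. I \<in> realised_sets n U \<Longrightarrow> (\<Sum>i\<in>I. c i) = 0"
    and nz: "(\<Sum>i\<in>{i\<in>{1..n}. g \<in> U i}. c i) \<noteq> 0"
  shows "g \<in> (\<Union>i\<in>{1..n}. exclusive_part {1..n} U i)"
proof -
  define I where "I = {i\<in>{1..n}. g \<in> U i}"
  have "g \<in> (\<Inter>i\<in>I. U i) - (\<Union>j \<in> {1..n} - I. U j)" by (auto simp: I_def)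
  moreover have "I \<notin> realised_sets n U" using rel[of I] nz by (auto simp: I_def)
  ultimately have "card I \<le> 1"
    unfolding realised_sets_def by (force simp: I_def)
  moreover have "I \<noteq> {}" using nz unfolding I_def[symmetric] by auto
  moreover have "finite I" by (simp add: I_def)
  ultimately have "card I = 1" by (simp add: Suc_leI card_gt_0_iff le_antisym)
  then obtain i where i: "I = {i}" by (auto simp: card_1_singleton_iff)
  have "k = i \<longleftrightarrow> k \<in> {1..n} \<and> g \<in> U k" for k using i by (auto simp: I_def)
  then have "i \<in> {1..n}" "g \<in> exclusive_part {1..n} U i"
    unfolding exclusive_part_def by blast+
  then show ?thesis by blast
qed

lemma sum_exclusive:
  assumes "j \<in> {1..n}" "g \<in> exclusive_part {1..n} U j"
  shows "{i\<in>{1..n}. g \<in> U i} = {j}"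
  using assms by (auto simp: exclusive_part_def)

section \<open>Interiors and exclusive parts\<close>

context etale_groupoid
begin

text \<open>The source map is open. So the condition in the unit space is the stronger one:
  \<open>condition_S\<close> is derived from the condition in \<open>G\<close>, while the converse
  construction establishes the one in the unit space.\<close>

lemma interior_of_src_image:
  assumes "unit_space G interior_of (gsrc G ` S) = {}"
  shows "gtop G interior_of S = {}"
proof -
  have "gsrc G ` (gtop G interior_of S) \<subseteq> unit_space G interior_of (gsrc G ` S)"
    by (intro interior_of_maximal image_mono interior_of_subset openin_src_image openin_interior_of)
  then show ?thesis using assms by blast
qed

text \<open>Finitely many sets with empty interior may well cover an open set, but exclusive parts
  are relatively closed in their bisections. For one index at a time, the open set shrinks to the
  source of the overlap of \<open>U i\<close> with the other bisections, which injectivity of the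
  source on \<open>U i\<close> keeps off the exclusive part.\<close>

lemma avoid_exclusive_parts:
  assumes U: "\<And>i. i \<in> A \<Longrightarrow> open_bisection G (U i)" "\<And>i. i \<in> A \<Longrightarrow> gsrc G ` U i = W"
    and empty: "\<And>i. i \<in> A \<Longrightarrow> gtop G interior_of exclusive_part A U i = {}"
    and B: "finite B" "B \<subseteq> A" and V: "openin (unit_space G) V" "V \<noteq> {}" "V \<subseteq> W"
  shows "\<exists>V'. openin (unit_space G) V' \<and> V' \<noteq> {} \<and> V' \<subseteq> V \<and>
    (\<forall>i\<in>B. V' \<inter> gsrc G ` exclusive_part A U i = {})"
  using B
proof (induction B rule: finite_induct)
  case empty
  then show ?case using V by blast
next
  case (insert i B)
  then have "B \<subseteq> A" by simp
  from insert.IH[OF this] obtain V' where V': "openin (unit_space G) V'" "V' \<noteq> {}" "V' \<subseteq> V"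
    "\<forall>i\<in>B. V' \<inter> gsrc G ` exclusive_part A U i = {}"
    by (elim exE conjE)
  have i: "i \<in> A" using insert by simp
  have open_U: "openin (gtop G) (U j)" if "j \<in> A" for j using U(1)[OF that] by (simp add: open_bisection_def)
  define S where "S = U i \<inter> (\<Union>j\<in>A - {i}. U j)"
  have S: "openin (gtop G) S" using open_U i by (auto simp: S_def)
  define V'' where "V'' = gsrc G ` {g \<in> S. gsrc G g \<in> V'}"
  have "openin (unit_space G) V''"
    unfolding V''_def by (intro openin_src_image openin_src_preimage S V'(1))
  \<comment> \<open>Otherwise the open set of points of \<open>U i\<close> over \<open>V'\<close>,
    nonempty since \<open>V'\<close> lies in the common source, would be contained in the exclusive
    part.\<close>
  moreover have "V'' \<noteq> {}"
  proof
    assume "V'' = {}"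
    then have "{g \<in> U i. gsrc G g \<in> V'} \<subseteq> exclusive_part A U i"
      by (auto simp: V''_def S_def exclusive_part_def)
    then have "{g \<in> U i. gsrc G g \<in> V'} \<subseteq> gtop G interior_of exclusive_part A U i"
      using openin_src_preimage[OF open_U[OF i] V'(1)] by (rule interior_of_maximal)
    then have "{g \<in> U i. gsrc G g \<in> V'} = {}" using empty[OF i] by blast
    then have "V' \<inter> gsrc G ` U i = {}" by blast
    then show False using V' V(3) U(2)[OF i] by blast
  qed
  moreover have "V'' \<subseteq> V'" by (auto simp: V''_def)
  moreover have "V'' \<inter> gsrc G ` exclusive_part A U i = {}"
  proof -
    have "g \<notin> exclusive_part A U i" if "h \<in> S" "gsrc G h = gsrc G g" for g h
    proof
      assume g: "g \<in> exclusive_part A U i"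
      then have "g = h"
        using U(1)[OF i] that by (auto simp: open_bisection_def inj_on_def S_def exclusive_part_def)
      with g that show False by (auto simp: S_def exclusive_part_def)
    qed
    then show ?thesis by (force simp: V''_def)
  qed
  moreover have "V'' \<inter> gsrc G ` exclusive_part A U k = {}" if "k \<in> B" for k
    using V'(4) \<open>V'' \<subseteq> V'\<close> that by blast
  ultimately have "openin (unit_space G) V'' \<and> V'' \<noteq> {} \<and> V'' \<subseteq> V \<and>
      (\<forall>k\<in>insert i B. V'' \<inter> gsrc G ` exclusive_part A U k = {})"
    using V'(3) by auto
  then show ?case ..
qed

lemma interior_of_exclusive_parts:
  assumes "finite A" and U: "\<And>i. i \<in> A \<Longrightarrow> open_bisection G (U i)" "\<And>i. i \<in> A \<Longrightarrow> gsrc G ` U i = W"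
    and empty: "\<And>i. i \<in> A \<Longrightarrow> gtop G interior_of exclusive_part A U i = {}"
  shows "unit_space G interior_of (gsrc G ` (\<Union>i\<in>A. exclusive_part A U i)) = {}"
proof (rule ccontr)
  let ?E = "gsrc G ` (\<Union>i\<in>A. exclusive_part A U i)"
  let ?V = "unit_space G interior_of ?E"
  assume "?V \<noteq> {}"
  have "?E \<subseteq> W" using U(2) by (auto simp: exclusive_part_def)
  then have "?V \<subseteq> W" by (rule order_trans[OF interior_of_subset])
  have "\<exists>V'. openin (unit_space G) V' \<and> V' \<noteq> {} \<and> V' \<subseteq> ?V \<and>
      (\<forall>i\<in>A. V' \<inter> gsrc G ` exclusive_part A U i = {})"
  proof (rule avoid_exclusive_parts)
    show "finite A" "?V \<noteq> {}" "?V \<subseteq> W" by fact+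
  qed (use U empty in simp_all)
  then obtain V' where V': "V' \<noteq> {}" "V' \<subseteq> ?V" "\<forall>i\<in>A. V' \<inter> gsrc G ` exclusive_part A U i = {}"
    by (elim exE conjE)
  from V'(1) obtain y where y: "y \<in> V'" by blast
  then have "y \<in> ?E" using V'(2) interior_of_subset by (rule subsetD[OF order_trans, rotated 2])
  then obtain i where "i \<in> A" "y \<in> gsrc G ` exclusive_part A U i" by blast
  with y V'(3) show False by blast
qed

section \<open>Local forms for both algebras\<close>

lemma continuous_map_section:
  assumes U: "open_bisection G U"
  shows "continuous_map (subtopology (unit_space G) (gsrc G ` U)) (subtopology (gtop G) U)
    (inv_into U (gsrc G))"
proof -
  obtain \<sigma> where \<sigma>: "homeomorphic_maps (subtopology (gtop G) U)
      (subtopology (unit_space G) (gsrc G ` U)) (gsrc G) \<sigma>"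
    using open_bisection_homeomorphic[OF U] homeomorphic_map_maps by blast
  have top: "topspace (subtopology (gtop G) U) = U"
    "topspace (subtopology (unit_space G) (gsrc G ` U)) = gsrc G ` U"
    using open_bisection_subset[OF U] src_in_units by (auto simp: mor_def)
  have "continuous_map (subtopology (unit_space G) (gsrc G ` U)) (subtopology (gtop G) U) \<sigma>"
    using \<sigma> by (simp add: homeomorphic_maps_def)
  moreover have "\<sigma> y = inv_into U (gsrc G) y" if y: "y \<in> gsrc G ` U" for y
  proof -
    obtain g where g: "g \<in> U" "y = gsrc G g" using y by blast
    then have "\<sigma> y = g" using \<sigma> top by (auto simp: homeomorphic_maps_def)
    then show ?thesis using g U by (simp add: open_bisection_def)
  qed
  ultimately show ?thesis by (rule continuous_map_eq) (use top in auto)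
qed

text \<open>Composing with the continuous inverse of the source on \<open>U i\<close> turns each
  term into a function of units. It is continuous only over the source of \<open>U i\<close>, so
  sums are considered on sets \<open>W\<close> inside all the sources involved.\<close>

lemma Cc_local_form:
  assumes f: "f \<in> Cc G" and x: "x \<in> units G"
  shows "\<exists>A W V F. local_form f x A W V F"
proof -
  obtain n :: nat and a p where f_eq: "f = (\<lambda>g. \<Sum>i<n. a i * p i g)"
    and "\<forall>i<n. \<exists>U. open_bisection G U \<and> p i \<in> Cc_on G U"
    using f unfolding Cc_def by blast
  then obtain U where U: "\<And>i. i < n \<Longrightarrow> open_bisection G (U i)"
    and p: "\<And>i. i < n \<Longrightarrow> p i \<in> Cc_on G (U i)" by metis
  have "\<forall>i. \<exists>K. i < n \<longrightarrow> compactin (gtop G) K \<and> K \<subseteq> U i \<and> (\<forall>g. g \<notin> K \<longrightarrow> p i g = 0)"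
    using Cc_on_compact[OF p open_bisection_subset[OF U]] by blast
  then obtain K where K: "\<And>i. i < n \<Longrightarrow> compactin (gtop G) (K i)" "\<And>i. i < n \<Longrightarrow> K i \<subseteq> U i"
    "\<And>i g. i < n \<Longrightarrow> g \<notin> K i \<Longrightarrow> p i g = 0" by metis
  define F where "F = (\<lambda>i y. a i * p i (inv_into (U i) (gsrc G) y))"
  have cont: "continuous_map (subtopology (unit_space G) W) euclidean (F i)"
    if i: "i < n" "W \<subseteq> gsrc G ` U i" for i W
  proof -
    have "continuous_map (subtopology (unit_space G) (gsrc G ` U i)) euclidean
        ((\<lambda>z. a i * z) \<circ> (p i \<circ> inv_into (U i) (gsrc G)))"
      using p[OF i(1)] continuous_map_section[OF U[OF i(1)]]
      by (intro continuous_map_compose[where X' = euclidean] continuous_map_compose)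
        (auto simp: Cc_on_def intro: continuous_intros)
    then have "continuous_map (subtopology (unit_space G) (gsrc G ` U i)) euclidean (F i)"
      by (simp add: F_def o_def)
    then show ?thesis using i(2) by (rule continuous_map_from_subtopology_mono)
  qed
  have "\<exists>A W V. local_form f x A W V F"
  proof (rule local_form_exists[OF x U K(1,2), where p = "\<lambda>i g. a i * p i g"])
    show "a i * p i g = F i (gsrc G g)" if "i < n" "g \<in> U i" for i g
      using U[OF that(1)] that(2) by (simp add: F_def open_bisection_def)
    show "openin (unit_space G) {y \<in> W. (\<Sum>i\<in>I. F i y) \<noteq> 0}"
      if I: "I \<subseteq> {..<n}" and W: "openin (unit_space G) W" and sub: "\<And>i. i \<in> I \<Longrightarrow> W \<subseteq> gsrc G ` U i"
      for I W
    proof -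
      have "continuous_map (subtopology (unit_space G) W) euclidean (\<lambda>y. \<Sum>i\<in>I. F i y)"
        using I sub finite_subset[OF I] by (intro continuous_map_sum cont) auto
      from openin_continuous_map_preimage[OF this, of "- {0}"]
      have "openin (subtopology (unit_space G) W)
        {y \<in> topspace (subtopology (unit_space G) W). (\<Sum>i\<in>I. F i y) \<in> - {0}}"
        by (simp add: open_Compl)
      moreover have "topspace (subtopology (unit_space G) W) = W"
        using openin_subset[OF W] by auto
      ultimately show ?thesis using W openin_trans_full by fastforce
    qed
  qed (use K f_eq in auto)
  then show ?thesis by blast
qed

text \<open>A compact bisection serves as its own compact set, and with constant coefficients a sum
  is nonzero on all of \<open>W\<close> or nowhere.\<close>

lemma steinberg_local_form:
  fixes f :: "'a \<Rightarrow> 'r::ring"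
  assumes f: "f \<in> steinberg_algebra G" and x: "x \<in> units G"
  shows "\<exists>A W V F. local_form f x A W V F"
proof -
  obtain n :: nat and c and U where f_eq: "f = (\<lambda>g. \<Sum>i<n. const_on (c i) (U i) g)"
    and U: "\<And>i. i < n \<Longrightarrow> open_bisection G (U i)" "\<And>i. i < n \<Longrightarrow> compactin (gtop G) (U i)"
    using f unfolding steinberg_algebra_def by blast
  have "\<exists>A W V. local_form f x A W V (\<lambda>i y. c i)"
  proof (rule local_form_exists[OF x U subset_refl, where p = "\<lambda>i. const_on (c i) (U i)"])
    show "openin (unit_space G) {y \<in> W. (\<Sum>i\<in>I. c i) \<noteq> 0}" if "openin (unit_space G) W" for I W
      using that by (cases "(\<Sum>i\<in>I. c i) = 0") simp_all
  qed (use f_eq in \<open>auto simp: const_on_def\<close>)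
  then show ?thesis by blast
qed

text \<open>The common start of both constructions of singular elements. The shared source
  \<open>W\<close> is what lets one cut-off serve all bisections.\<close>

lemma condition_S_imp_relation:
  assumes t: "t \<in> ring_ords TYPE('r::ring)" and S: "condition_S t G"
  obtains n U W j and c :: "nat \<Rightarrow> 'r::ring" where
    "\<And>i. i \<in> {1..n} \<Longrightarrow> open_bisection G (U i)" "\<And>i. i \<in> {1..n} \<Longrightarrow> gsrc G ` U i = W"
    "unit_space G interior_of (gsrc G ` (\<Union>i\<in>{1..n}. exclusive_part {1..n} U i)) = {}"
    "j \<in> {1..n}" "c j \<noteq> 0" "exclusive_part {1..n} U j \<noteq> {}"
    "\<And>I. I \<in> realised_sets n U \<Longrightarrow> (\<Sum>i\<in>I. c i) = 0"
proof -
  obtain x :: 'r where x: "x \<noteq> 0" "add_ord x = t" using t by (auto simp: ring_ords_def)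
  then have "t \<noteq> 1" using add_ord_eq_1_iff by blast
  obtain n U j0 where n: "n > 0" and U: "\<forall>i \<in> {1..n}. open_bisection G (U i)"
    "\<forall>i \<in> {1..n}. \<forall>j \<in> {1..n}. gsrc G ` U i = gsrc G ` U j"
    and ex: "\<forall>i \<in> {1..n}. exclusive_part {1..n} U i \<noteq> {} \<and>
        gtop G interior_of exclusive_part {1..n} U i = {}"
    and j0: "j0 \<in> {1..n}" "\<not> generated t n (realised_sets n U) j0"
    using S unfolding condition_S_iff[OF \<open>t \<noteq> 1\<close>] by blast
  obtain c :: "nat \<Rightarrow> 'r" and j where c: "j \<in> {1..n}" "c j \<noteq> 0"
    "\<And>I. I \<in> realised_sets n U \<Longrightarrow> (\<Sum>i\<in>I. c i) = 0"
    using not_generated_imp_relation[OF x j0 finite_realised_sets] by (auto simp: realised_sets_def)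
  have W: "gsrc G ` U i = gsrc G ` U j0" if "i \<in> {1..n}" for i using U(2) that j0(1) by blast
  have "unit_space G interior_of (gsrc G ` (\<Union>i\<in>{1..n}. exclusive_part {1..n} U i)) = {}"
    using U(1) W ex by (intro interior_of_exclusive_parts) auto
  with U(1) W ex c show thesis using that[of n U "gsrc G ` U j0" j c] by blast
qed

text \<open>The closure of the support is taken in \<open>U\<close>. There the lift of
  \<open>C\<close> is compact, and it is closed as the preimage of a closed set, so it contains that
  closure.\<close>

lemma pullback_in_Cc_on:
  assumes U: "open_bisection G U" and h: "continuous_map (unit_space G) euclideanreal h"
    and C: "compactin (unit_space G) C" "C \<subseteq> gsrc G ` U" "\<And>y. y \<in> units G - C \<Longrightarrow> h y = 0"
  shows "(\<lambda>g. if g \<in> U then complex_of_real (h (gsrc G g)) else 0) \<in> Cc_on G U"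
proof -
  let ?p = "\<lambda>g. if g \<in> U then complex_of_real (h (gsrc G g)) else 0"
  let ?X = "subtopology (gtop G) U"
  define K where "K = {g \<in> U. gsrc G g \<in> C}"
  have sub: "U \<subseteq> mor G" using open_bisection_subset[OF U] .
  have top: "topspace ?X = U" using sub by (auto simp: mor_def)
  have src: "continuous_map ?X (unit_space G) (gsrc G)"
    using continuous_src by (rule continuous_map_from_subtopology)
  have "continuous_map ?X euclidean (complex_of_real \<circ> (h \<circ> gsrc G))"
    using src h by (intro continuous_map_compose[where X' = euclideanreal] continuous_map_compose)
      (auto intro: continuous_intros)
  then have cont: "continuous_map ?X euclidean ?p"
    by (rule continuous_map_eq) (simp add: top)
  have "compactin (gtop G) K" unfolding K_def by (rule compactin_lift[OF U C(1,2)])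
  then have K: "compactin ?X K" by (auto simp: compactin_subtopology K_def)
  have "closedin (unit_space G) C" using compactin_imp_closedin[OF Hausdorff_units C(1)] .
  from closedin_continuous_map_preimage[OF src this]
  have "closedin ?X K" unfolding top K_def .
  moreover have "{g \<in> U. ?p g \<noteq> 0} \<subseteq> K"
    using C(3) src_in_units sub by (auto simp: K_def)
  ultimately have "?X closure_of {g \<in> U. ?p g \<noteq> 0} \<subseteq> K" by (rule closure_of_minimal[rotated])
  then have "compactin ?X (?X closure_of {g \<in> U. ?p g \<noteq> 0})"
    by (rule closed_compactin[OF K _ closedin_closure_of])
  with cont show ?thesis by (simp add: Cc_on_def)
qed

section \<open>Elements of the singular ideals\<close>

lemma Cc_outside:
  assumes "f \<in> Cc G" "g \<notin> mor G"
  shows "f g = 0"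
proof -
  obtain n :: nat and a p where "f = (\<lambda>g. \<Sum>i<n. a i * p i g)"
    "\<forall>i<n. \<exists>U. open_bisection G U \<and> p i \<in> Cc_on G U"
    using assms(1) unfolding Cc_def by blast
  moreover from this have "p i g = 0" if "i < n" for i
    using open_bisection_subset assms(2) that by (fastforce simp: Cc_on_def)
  ultimately show ?thesis by simp
qed

lemma steinberg_outside:
  assumes "f \<in> steinberg_algebra G" "g \<notin> mor G"
  shows "f g = 0"
proof -
  obtain n :: nat and c and U where "f = (\<lambda>g. \<Sum>i<n. const_on (c i) (U i) g)"
    and U: "\<And>i. i < n \<Longrightarrow> open_bisection G (U i)"
    using assms(1) unfolding steinberg_algebra_def by blast
  moreover have "g \<notin> U i" if "i < n" for i using open_bisection_subset[OF U[OF that]] assms(2) by blast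
  ultimately show ?thesis by (simp add: const_on_def)
qed

lemma singular_ideal_Cc_iff:
  assumes "f \<in> Cc G"
  shows "regular_rep G f \<in> singular_ideal G
    \<longleftrightarrow> unit_space G interior_of (gsrc G ` osupp G f) = {}"
proof -
  have "osupp G (as_function G (regular_rep G f)) = osupp G f"
    by (auto simp: osupp_def as_function_regular_rep)
  then show ?thesis using regular_rep_in_reduced_Cstar[OF assms] by (simp add: singular_ideal_def)
qed

lemma zero_in_Cc: "(\<lambda>g. 0) \<in> Cc G"
  unfolding Cc_def by (auto intro!: exI[of _ "0::nat"])

lemma zero_in_steinberg_algebra: "(\<lambda>g. 0) \<in> steinberg_algebra G"
  unfolding steinberg_algebra_def by (auto intro!: exI[of _ "0::nat"])

lemma regular_rep_eq_iff:
  assumes "f \<in> Cc G"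
  shows "regular_rep G f = regular_rep G (\<lambda>g. 0) \<longleftrightarrow> (\<forall>g\<in>mor G. f g = 0)"
proof
  assume "regular_rep G f = regular_rep G (\<lambda>g. 0)"
  then show "\<forall>g\<in>mor G. f g = 0"
    using as_function_regular_rep[of _ f] as_function_regular_rep[of _ "\<lambda>g. 0"] by metis
next
  assume "\<forall>g\<in>mor G. f g = 0"
  then have "f = (\<lambda>g. 0)" using Cc_outside[OF assms] by blast
  then show "regular_rep G f = regular_rep G (\<lambda>g. 0)" by simp
qed

text \<open>Makes the argument for arbitrary rings yield exactly \<open>condition_S 0\<close> for
  functions in \<open>Cc G\<close>.\<close>

lemma ring_ords_complex: "ring_ords TYPE(complex) = {0}"
proof -
  have "add_ord (1::complex) = 0" by (rule add_ord_complex) simp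
  then have "0 \<in> ring_ords TYPE(complex)"
    unfolding ring_ords_def by (intro CollectI exI[of _ 1] conjI) simp_all
  moreover have "ring_ords TYPE(complex) \<subseteq> {0}"
    by (auto simp: ring_ords_def add_ord_complex)
  ultimately show ?thesis by blast
qed

text \<open>The representation is injective on \<open>Cc G\<close>, so this set of operator families
  can be examined through functions.\<close>

lemma singular_ideal_Cc_nonzero_iff:
  "singular_ideal G \<inter> regular_rep G ` Cc G \<noteq> {regular_rep G (\<lambda>g. 0)}
    \<longleftrightarrow> (\<exists>f\<in>Cc G. unit_space G interior_of (gsrc G ` osupp G f) = {} \<and> (\<exists>g\<in>mor G. f g \<noteq> 0))"
proof -
  have "regular_rep G (\<lambda>g. 0) \<in> singular_ideal G"
    using singular_ideal_Cc_iff[OF zero_in_Cc] by (simp add: osupp_def)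
  then have "singular_ideal G \<inter> regular_rep G ` Cc G \<noteq> {regular_rep G (\<lambda>g. 0)}
    \<longleftrightarrow> (\<exists>f\<in>Cc G. regular_rep G f \<in> singular_ideal G \<and> regular_rep G f \<noteq> regular_rep G (\<lambda>g. 0))"
    using zero_in_Cc by blast
  then show ?thesis using singular_ideal_Cc_iff regular_rep_eq_iff by auto
qed

lemma singular_Cc_imp_condition_S:
  assumes "f \<in> Cc G" "unit_space G interior_of (gsrc G ` osupp G f) = {}" "g \<in> mor G" "f g \<noteq> 0"
  shows "condition_S 0 G"
  using singular_imp_condition_S[OF Cc_local_form[OF assms(1)] assms(3,4) interior_of_src_image[OF assms(2)]]
  by (simp add: ring_ords_complex)

text \<open>The cut-off \<open>h\<close> on the common source multiplies all terms by the same
  factor. So \<open>f\<close> is that factor times the sum of the \<open>c i\<close> over the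
  bisections through the point, and the relations stay intact.\<close>

lemma condition_S_imp_singular_Cc:
  assumes "condition_S 0 G"
  shows "\<exists>f\<in>Cc G. unit_space G interior_of (gsrc G ` osupp G f) = {} \<and> (\<exists>g\<in>mor G. f g \<noteq> 0)"
proof -
  have "0 \<in> ring_ords TYPE(complex)" by (simp add: ring_ords_complex)
  from this assms obtain n U W j and c :: "nat \<Rightarrow> complex" where
    U: "\<And>i. i \<in> {1..n} \<Longrightarrow> open_bisection G (U i)" "\<And>i. i \<in> {1..n} \<Longrightarrow> gsrc G ` U i = W"
    and int: "unit_space G interior_of (gsrc G ` (\<Union>i\<in>{1..n}. exclusive_part {1..n} U i)) = {}"
    and j: "j \<in> {1..n}" "c j \<noteq> 0" "exclusive_part {1..n} U j \<noteq> {}"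
    and c: "\<And>I. I \<in> realised_sets n U \<Longrightarrow> (\<Sum>i\<in>I. c i) = 0"
    by (rule condition_S_imp_relation) (rule that; assumption)
  obtain g where g: "g \<in> exclusive_part {1..n} U j" using j(3) by blast
  have gU: "g \<in> U j" using g by (simp add: exclusive_part_def)
  have W: "openin (unit_space G) W"
    using openin_src_image U[OF j(1)] by (auto simp: open_bisection_def)
  have gW: "gsrc G g \<in> W" using gU U(2)[OF j(1)] by blast
  obtain h C where h: "continuous_map (unit_space G) euclideanreal h" "h (gsrc G g) = 1"
    and C: "compactin (unit_space G) C" "C \<subseteq> W" "\<forall>y \<in> units G - C. h y = 0"
    using bump_function[OF locally_compact_unit_space Hausdorff_units W gW]
    unfolding topspace_unit_space by blast
  define p where "p = (\<lambda>i g. if g \<in> U i then complex_of_real (h (gsrc G g)) else 0)"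
  \<comment> \<open>\<open>Cc\<close> numbers its terms from 0, \<open>condition_S\<close> its
    bisections from 1; hence the shift by \<open>Suc\<close>.\<close>
  define f where "f = (\<lambda>g. \<Sum>i<n. c (Suc i) * p (Suc i) g)"
  have p: "p i \<in> Cc_on G (U i)" if "i \<in> {1..n}" for i
    unfolding p_def using pullback_in_Cc_on[OF U(1)[OF that] h(1) C(1)] U(2)[OF that] C by simp
  have "open_bisection G (U (Suc i)) \<and> p (Suc i) \<in> Cc_on G (U (Suc i))" if "i < n" for i
    using U p that by simp
  then have "f \<in> Cc G"
    unfolding Cc_def f_def
    by (intro CollectI exI[of _ n] exI[of _ "\<lambda>i. c (Suc i)"] exI[of _ "\<lambda>i. p (Suc i)"]) blast
  have f_eq: "f g = of_real (h (gsrc G g)) * (\<Sum>i\<in>{i\<in>{1..n}. g \<in> U i}. c i)" for g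
  proof -
    have "f g = (\<Sum>i=1..n. c i * p i g)"
      unfolding f_def using sum.shift_bounds_Suc_ivl[of "\<lambda>i. c i * p i g" 0 n]
      by (simp add: atLeast0LessThan atLeastLessThanSuc_atLeastAtMost)
    also have "\<dots> = (\<Sum>i\<in>{i\<in>{1..n}. g \<in> U i}. c i * p i g)"
      by (intro sum.mono_neutral_right) (auto simp: p_def)
    also have "\<dots> = (\<Sum>i\<in>{i\<in>{1..n}. g \<in> U i}. of_real (h (gsrc G g)) * c i)"
      by (intro sum.cong) (auto simp: p_def)
    finally show ?thesis by (simp only: sum_distrib_left)
  qed
  have "osupp G f \<subseteq> (\<Union>i\<in>{1..n}. exclusive_part {1..n} U i)"
  proof
    fix g assume "g \<in> osupp G f"
    then have "(\<Sum>i\<in>{i\<in>{1..n}. g \<in> U i}. c i) \<noteq> 0" by (auto simp: osupp_def f_eq)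
    with c show "g \<in> (\<Union>i\<in>{1..n}. exclusive_part {1..n} U i)" by (rule sum_realised)
  qed
  then have "unit_space G interior_of (gsrc G ` osupp G f)
      \<subseteq> unit_space G interior_of (gsrc G ` (\<Union>i\<in>{1..n}. exclusive_part {1..n} U i))"
    by (intro interior_of_mono image_mono)
  then have "unit_space G interior_of (gsrc G ` osupp G f) = {}" unfolding int by (rule subset_empty[THEN iffD1])
  moreover have "f g \<noteq> 0" unfolding f_eq sum_exclusive[OF j(1) g] using h(2) j(2) by simp
  moreover have "g \<in> mor G" using gU open_bisection_subset[OF U(1)[OF j(1)]] by blast
  ultimately show ?thesis using \<open>f \<in> Cc G\<close> by blast
qed

end

text \<open>A compact open set \<open>K\<close> of units, available by total disconnectedness, takes
  the place of the bump function. It makes the restricted bisections compact while the coefficients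
  stay constant.\<close>

lemma (in ample_groupoid) condition_S_imp_singular_steinberg:
  assumes "t \<in> ring_ords TYPE('r::ring)" "condition_S t G"
  shows "\<exists>f\<in>steinberg_singular_ideal G. f \<noteq> (\<lambda>g. 0::'r)"
proof -
  from assms obtain n U W j and c :: "nat \<Rightarrow> 'r" where
    U: "\<And>i. i \<in> {1..n} \<Longrightarrow> open_bisection G (U i)" "\<And>i. i \<in> {1..n} \<Longrightarrow> gsrc G ` U i = W"
    and int: "unit_space G interior_of (gsrc G ` (\<Union>i\<in>{1..n}. exclusive_part {1..n} U i)) = {}"
    and j: "j \<in> {1..n}" "c j \<noteq> 0" "exclusive_part {1..n} U j \<noteq> {}"
    and c: "\<And>I. I \<in> realised_sets n U \<Longrightarrow> (\<Sum>i\<in>I. c i) = 0"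
    by (rule condition_S_imp_relation) (rule that; assumption)
  obtain g where g: "g \<in> exclusive_part {1..n} U j" using j(3) by blast
  have gU: "g \<in> U j" using g by (simp add: exclusive_part_def)
  have W: "openin (unit_space G) W"
    using openin_src_image U[OF j(1)] by (auto simp: open_bisection_def)
  have gW: "gsrc G g \<in> W" using gU U(2)[OF j(1)] by blast
  obtain K where K: "openin (unit_space G) K" "compactin (unit_space G) K"
    "gsrc G g \<in> K" "K \<subseteq> W"
    using compact_open_neighbourhood[OF locally_compact_unit_space Hausdorff_units totally_disconnected W gW]
    by blast
  define V where "V = (\<lambda>i. {g \<in> U i. gsrc G g \<in> K})"
  have V: "open_bisection G (V i)" "compactin (gtop G) (V i)" if "i \<in> {1..n}" for i
    unfolding V_def using open_bisection_restrict[OF U(1)[OF that] K(1)]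
      compactin_lift[OF U(1)[OF that] K(2)] U(2)[OF that] K(4) by auto
  define f where "f = (\<lambda>g. \<Sum>i<n. const_on (c (Suc i)) (V (Suc i)) g)"
  have "open_bisection G (V (Suc i)) \<and> compactin (gtop G) (V (Suc i))" if "i < n" for i
    using V that by simp
  then have "f \<in> steinberg_algebra G"
    unfolding steinberg_algebra_def f_def
    by (intro CollectI exI[of _ n] exI[of _ "\<lambda>i. c (Suc i)"] exI[of _ "\<lambda>i. V (Suc i)"]) blast
  have f_eq: "f g = (if gsrc G g \<in> K then \<Sum>i\<in>{i\<in>{1..n}. g \<in> U i}. c i else 0)" for g
  proof -
    have "f g = (\<Sum>i=1..n. const_on (c i) (V i) g)"
      unfolding f_def using sum.shift_bounds_Suc_ivl[of "\<lambda>i. const_on (c i) (V i) g" 0 n]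
      by (simp add: atLeast0LessThan atLeastLessThanSuc_atLeastAtMost)
    also have "\<dots> = (\<Sum>i\<in>{i\<in>{1..n}. g \<in> U i}. const_on (c i) (V i) g)"
      by (intro sum.mono_neutral_right) (auto simp: const_on_def V_def)
    also have "\<dots> = (\<Sum>i\<in>{i\<in>{1..n}. g \<in> U i}. if gsrc G g \<in> K then c i else 0)"
      by (intro sum.cong) (auto simp: const_on_def V_def)
    finally show ?thesis by simp
  qed
  have "osupp G f \<subseteq> (\<Union>i\<in>{1..n}. exclusive_part {1..n} U i)"
  proof
    fix g assume "g \<in> osupp G f"
    then have "(\<Sum>i\<in>{i\<in>{1..n}. g \<in> U i}. c i) \<noteq> 0" by (auto simp: osupp_def f_eq split: if_splits)
    with c show "g \<in> (\<Union>i\<in>{1..n}. exclusive_part {1..n} U i)" by (rule sum_realised)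
  qed
  then have "gtop G interior_of osupp G f
      \<subseteq> gtop G interior_of (\<Union>i\<in>{1..n}. exclusive_part {1..n} U i)"
    by (rule interior_of_mono)
  then have "gtop G interior_of osupp G f = {}"
    unfolding interior_of_src_image[OF int] by (rule subset_empty[THEN iffD1])
  moreover have "f g \<noteq> 0" using K(3) j(2) unfolding f_eq sum_exclusive[OF j(1) g] by simp
  ultimately show ?thesis
    using \<open>f \<in> steinberg_algebra G\<close> unfolding steinberg_singular_ideal_def by force
qed

lemma (in etale_groupoid) singular_steinberg_imp_condition_S:
  assumes "(f :: 'a \<Rightarrow> 'r::ring) \<in> steinberg_singular_ideal G" "f \<noteq> (\<lambda>g. 0)"
  shows "\<exists>t \<in> ring_ords TYPE('r). condition_S t G"
proof -
  have f: "f \<in> steinberg_algebra G" "gtop G interior_of osupp G f = {}"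
    using assms(1) by (auto simp: steinberg_singular_ideal_def)
  obtain g where "f g \<noteq> 0" using assms(2) by blast
  moreover from this have "g \<in> mor G" using steinberg_outside[OF f(1)] by blast
  ultimately show ?thesis using singular_imp_condition_S[OF steinberg_local_form[OF f(1)]] f(2) by blast
qed

theorem theorem1:
  fixes G :: "'g top_groupoid"
  assumes "etale_groupoid G"
    and "\<not> Hausdorff_space (gtop G)"
  shows "(singular_ideal G \<inter> regular_rep G ` Cc G \<noteq> {regular_rep G (\<lambda>g. 0)}
            \<longleftrightarrow> condition_S 0 G) \<and>
         (ample_groupoid G \<longrightarrow>
           ((steinberg_singular_ideal G :: ('g \<Rightarrow> 'r::ring) set) \<noteq> {\<lambda>g. 0}
              \<longleftrightarrow> (\<exists>t \<in> ring_ords TYPE('r). condition_S t G)))"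
proof (intro conjI impI)
  interpret etale_groupoid G by fact
  show "singular_ideal G \<inter> regular_rep G ` Cc G \<noteq> {regular_rep G (\<lambda>g. 0)} \<longleftrightarrow> condition_S 0 G"
    unfolding singular_ideal_Cc_nonzero_iff
    using singular_Cc_imp_condition_S condition_S_imp_singular_Cc by blast
  assume "ample_groupoid G"
  then interpret ample: ample_groupoid G .
  have "(\<lambda>g. 0) \<in> (steinberg_singular_ideal G :: ('g \<Rightarrow> 'r) set)"
    using zero_in_steinberg_algebra by (simp add: steinberg_singular_ideal_def osupp_def)
  then have "(steinberg_singular_ideal G :: ('g \<Rightarrow> 'r) set) \<noteq> {\<lambda>g. 0}
      \<longleftrightarrow> (\<exists>f\<in>steinberg_singular_ideal G. f \<noteq> (\<lambda>g. 0::'r))"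
    by blast
  then show "(steinberg_singular_ideal G :: ('g \<Rightarrow> 'r) set) \<noteq> {\<lambda>g. 0}
      \<longleftrightarrow> (\<exists>t \<in> ring_ords TYPE('r). condition_S t G)"
    using singular_steinberg_imp_condition_S ample.condition_S_imp_singular_steinberg by blast
qed

end
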